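(* (a) Consider weakly coupled dynamic programs with varying number $N$ of subproblems, with $\beta\in(0,1)$ and the number $L$ of linking constraints fixed, and additively separable $H(\mathbf x)=\theta+\sum_{n=1}^NH^n(x^n)$ (where $\theta$ and the $H^n$ may depend on $N$), such that for each $N$ Assumptions 1, 2 and 3 (stated in the context) hold for every $\omega\in\Omega$ and $T\in\mathbb N$. Let $$\Gamma^n=\sup_{x_0^n\in\mathcal X^n,\,a_0^n\in\mathcal A^n(x_0^n)}\{R^n(x_0^n,a_0^n)+\beta\,\mathbb E[H^n(x_1^n)\mid x_0^n,a_0^n]-H^n(x_0^n)\}-\inf_{x_0^n\in\mathcal X^n,\,a_0^n\in\mathcal A^n(x_0^n)}\{R^n(x_0^n,a_0^n)+\beta\,\mathbb E[H^n(x_1^n)\mid x_0^n,a_0^n]-H^n(x_0^n)\}.$$ If the $\Gamma^n$ are uniformly bounded over all subproblems (i.e. by a constant independent of $n$ and $N$), then $\mathcal L^\circ H(\mathbf x)-\mathcal LH(\mathbf x)$ is also uniformly bounded with respect to the number of subproblems $N$. (b) Let $\boldsymbol\lambda\ge0$ in $\mathbb R^L$ and $H(\mathbf x)=J^{\boldsymbol\lambda}(\mathbf x)=\frac{\boldsymbol\lambda^\top\mathbf b}{1-\beta}+\sum_{n=1}^NH^{n,\boldsymbol\lambda}(x^n)$, and define $$\Gamma^n=\sup_{x_0^n\in\mathcal X^n,\,a_0^n\in\mathcal A^n(x_0^n)}\{R^n(x_0^n,a_0^n)+\beta\,\mathbb E[H^{n,\boldsymbol\lambda}(x_1^n)\mid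 x_0^n,a_0^n]-H^{n,\boldsymbol\lambda}(x_0^n)\}-\inf_{x_0^n\in\mathcal X^n,\,a_0^n\in\mathcal A^n(x_0^n)}\{R^n(x_0^n,a_0^n)+\beta\,\mathbb E[H^{n,\boldsymbol\lambda}(x_1^n)\mid x_0^n,a_0^n]-H^{n,\boldsymbol\lambda}(x_0^n)\}.$$ Suppose there exists a constant $C>0$ such that $|R^n|$ and $|R^n-\boldsymbol\lambda^\top\mathbf B^n|$, $n=1,\dots,N$, are uniformly bounded by $C$. Then $\Gamma^n\le\frac{4C}{1-\beta}$ for all $n=1,\dots,N$.
   Context: Weakly coupled dynamic program. Fix integers $N,L\ge1$, a discount factor $\beta\in(0,1)$ and $\mathbf b\in\mathbb R^L$. For $n=1,\dots,N$, project (subproblem) $n$ has a state space $\mathcal X^n$, action sets $\mathcal A^n(x^n)$ (subsets of a Euclidean space) for $x^n\in\mathcal X^n$, a controlled transition kernel $P_n(\cdot\mid x^n,a^n)$, a bounded reward $R^n(x^n,a^n)\in\mathbb R$, and a constraint function $\mathbf B^n(x^n,a^n)\in\mathbb R^L$. Put $\mathcal X=\prod_n\mathcal X^n$, $\mathcal A(\mathbf x)=\prod_n\mathcal A^n(x^n)$, $R(\mathbf x,\mathbf a)=\sum_nR^n(x^n,a^n)$, $\mathbf B(\mathbf x,\mathbf a)=\sum_n\mathbf B^n(x^n,a^n)$, and $\bar{\mathcal A}(\mathbf x)=\{\mathbf a\in\mathcal A(\mathbf x):\mathbf B(\mathbf x,\mathbf a)\le\mathbf b\}$ (componentwise). The joint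 transition law is the product $P(\cdot\mid\mathbf x,\mathbf a)=\prod_nP_n(\cdot\mid x^n,a^n)$; $\mathbb E[H(\mathbf x_{t+1})\mid\mathbf x_t,\mathbf a_t]$ denotes the integral of $H$ against $P(\cdot\mid\mathbf x_t,\mathbf a_t)$, and $\mathbb E[H^n(x^n_{t+1})\mid x^n_t,a^n_t]$ the integral of $H^n$ against $P_n(\cdot\mid x^n_t,a^n_t)$. The functions $H^n:\mathcal X^n\to\mathbb R$ are bounded and measurable and $\theta\in\mathbb R$. Lagrangian bound. For $\boldsymbol\lambda\ge0$, $J^{\boldsymbol\lambda}(\mathbf x_0)$ is the maximum over non-anticipative policies with $\mathbf a_t\in\mathcal A(\mathbf x_t)$ (linking constraint not imposed) of $\mathbb E[\sum_{t\ge0}\beta^t(R(\mathbf x_t,\mathbf a_t)+\boldsymbol\lambda^\top[\mathbf b-\mathbf B(\mathbf x_t,\mathbf a_t)])\mid\mathbf x_0]$. It decomposes as $J^{\boldsymbol\lambda}(\mathbf x)=\frac{\boldsymbol\lambda^\top\mathbf b}{1-\beta}+\sum_{n=1}^NH^{n,\boldsymbol\lambda}(x^n)$, where $H^{n,\boldsymbol\lambda}$ is the bounded solution of the Bellman equation $$H^{n,\boldsymbol\lambda}(x_0^n)=\max_{a_0^n\in\mathcal A^n(x_0^n)}\{R^n(x_0^n,a_0^n)-\boldsymbol\lambda^\top\mathbf B^n(x_0^n,a_0^n)+\beta\,\mathbb E[H^{n,\boldsymbol\lambda}(x_1^n)\mid x_0^n,a_0^n]\}.$$ Scenarios. On a probability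 space $(\Omega,\mathcal F,P)$ the state of each project is a function of the scenario $\omega$ and of that project's past controls: $x^n_0=x^n_0(\omega)$, $x^n_{t+1}=x^n_{t+1}(a^n_0,\dots,a^n_t,\omega)$, and $\mathbf x_t=(x_t^1,\dots,x_t^N)$. $\tau$ is a random time with $P(\tau=t)=(1-\beta)\beta^t$, $t=0,1,2,\dots$, independent of $\omega$. For $T\in\mathbb N=\{0,1,\dots\}$ and a scenario $\omega$: $\mathcal A(T)$ (resp. $\bar{\mathcal A}(T)$) is the set of $(\mathbf a_0,\dots,\mathbf a_T)$ with $\mathbf a_t\in\mathcal A(\mathbf x_t)$ (resp. $\mathbf a_t\in\bar{\mathcal A}(\mathbf x_t)$) along the trajectory they generate, and $\mathcal A^n(T)$ is the set of $\mathbf a^n=(a^n_0,\dots,a^n_T)$ with $a^n_t\in\mathcal A^n(x^n_t)$ along the trajectory of project $n$ they generate. Information relaxation bounds. For $\boldsymbol\mu=(\boldsymbol\mu_0,\dots,\boldsymbol\mu_\tau)$, $\boldsymbol\mu_t\in\mathbb R^L_+$, let $$I_H(\mathbf a,\omega,\tau;\boldsymbol\mu)=\sum_{t=0}^{\tau}\Big(R(\mathbf x_t,\mathbf a_t)+\beta\,\mathbb E[H(\mathbf x_{t+1})\mid\mathbf x_t,\mathbf a_t]-H(\mathbf x_t)+\boldsymbol\mu_t^\top[\mathbf b-\mathbf B(\mathbf x_t,\mathbf a_t)]\Big),$$ $$\mathcal LH(\mathbf x_0)=H(\mathbf x_0)+\mathbb E\Big[\max_{\mathbf a\in\bar{\mathcal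 A}(\tau)}I_H(\mathbf a,\omega,\tau;0)\Big|\mathbf x_0\Big],\qquad\mathcal L^\circ H(\mathbf x_0)=H(\mathbf x_0)+\mathbb E\Big[\min_{\boldsymbol\mu\ge0}\max_{\mathbf a\in\mathcal A(\tau)}I_H(\mathbf a,\omega,\tau;\boldsymbol\mu)\Big|\mathbf x_0\Big].$$ Optimizations are done for each fixed $(\omega,\tau)$, and the expectations are over both $\omega$ and $\tau$. Maxima and minima written are assumed to exist (otherwise read as suprema/infima) and to be measurable in $\omega$. For $\mathbf a^n\in\mathcal A^n(T)$ write $\mathbf B^n_t(\mathbf a^n,\omega)=\mathbf B^n(x^n_t,a^n_t)$ and $I^n_{H^n}(\mathbf a^n,\omega,T)=\sum_{t=0}^T(R^n(x^n_t,a^n_t)+\beta\,\mathbb E[H^n(x^n_{t+1})\mid x^n_t,a^n_t]-H^n(x^n_t))$. Assumption 1: $\bar{\mathcal A}(\mathbf x)\ne\emptyset$ for every $\mathbf x\in\mathcal X$. Assumption 2 (for given $\omega,T$): for each $n$ the set $\{(\mathbf a^n,\mathbf B^n_0(\mathbf a^n,\omega),\dots,\mathbf B^n_T(\mathbf a^n,\omega),I^n_{H^n}(\mathbf a^n,\omega,T)):\mathbf a^n\in\mathcal A^n(T)\}$ is nonempty and compact. Assumption 3 (for given $\omega,T$): for each $n$ and every $\tilde{\mathbf a}^n\in\mathrm{conv}(\mathcal A^n(T))$ there exists $\mathbf a^n\in\mathcal A^n(T)$ such that $\mathbf B^n_t(\mathbf a^n,\omega)\le(\check{\mathrm{cl}}\,\mathbf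 B^n_t)(\tilde{\mathbf a}^n,\omega)$ componentwise for all $t=0,\dots,T$, where, componentwise, $$\check{\mathrm{cl}}\,\mathbf B^n_t(\tilde{\mathbf a}^n,\omega)=\inf\Big\{\sum_kp^k\mathbf B^n_t(\mathbf a^{n,k},\omega):\ \tilde{\mathbf a}^n=\sum_kp^k\mathbf a^{n,k},\ \mathbf a^{n,k}\in\mathcal A^n(T),\ \sum_kp^k=1,\ p^k\ge0\Big\},$$ all sums being finite. *)

theory Defs
  imports "HOL-Probability.Probability"
begin

text \<open>
  The state spaces of all subproblems are carriers inside one type \<open>'s\<close> (a disjoint union, if they
  are of different nature). The dimension of the Euclidean action space may differ between the
  subproblems: a vector of dimension \<open>d\<close> is a function in \<open>extensional {..<d}\<close>. On these functions the
  product topology of \<open>nat \<Rightarrow> real\<close> is the Euclidean topology. The constraint vectors live in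
  \<open>real ^ 'l\<close>, whose order is componentwise; the number of linking constraints is \<open>CARD('l)\<close>.
\<close>

type_synonym action = "nat \<Rightarrow> real"

record ('s, 'l) project =
  states :: "'s measure"
  adim :: nat
  acts :: "'s \<Rightarrow> action set"
  trans_law :: "'s \<Rightarrow> action \<Rightarrow> 's measure"
  rew :: "'s \<Rightarrow> action \<Rightarrow> real"
  constr :: "'s \<Rightarrow> action \<Rightarrow> real ^ 'l"

definition feas :: "('s, 'l::finite) project \<Rightarrow> ('s \<times> action) set" where
  "feas p = {(x, a). x \<in> space (states p) \<and> a \<in> acts p x}"

definition is_project :: "('s, 'l::finite) project \<Rightarrow> bool" where
  "is_project p \<longleftrightarrow>
     space (states p) \<noteq> {} \<and>
     (\<forall>x\<in>space (states p). acts p x \<subseteq> extensional {..<adim p}) \<and>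
     (\<lambda>(x, a). trans_law p x a)
       \<in> restrict_space (states p \<Otimes>\<^sub>M borel) (feas p) \<rightarrow>\<^sub>M prob_algebra (states p) \<and>
     bounded ((\<lambda>(x, a). rew p x a) ` feas p)"

definition bounded_measurable :: "'s measure \<Rightarrow> ('s \<Rightarrow> real) \<Rightarrow> bool" where
  "bounded_measurable M h \<longleftrightarrow> h \<in> borel_measurable M \<and> bounded (h ` space M)"

definition stage_gain :: "real \<Rightarrow> ('s, 'l::finite) project \<Rightarrow> ('s \<Rightarrow> real) \<Rightarrow> 's \<Rightarrow> action \<Rightarrow> real" where
  "stage_gain \<beta> p h x a = rew p x a + \<beta> * (\<integral>y. h y \<partial>trans_law p x a) - h x"

definition Gam :: "real \<Rightarrow> ('s, 'l::finite) project \<Rightarrow> ('s \<Rightarrow> real) \<Rightarrow> real" where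
  "Gam \<beta> p h = (SUP (x, a)\<in>feas p. stage_gain \<beta> p h x a) - (INF (x, a)\<in>feas p. stage_gain \<beta> p h x a)"

definition bellman_solution ::
  "real \<Rightarrow> real ^ 'l \<Rightarrow> ('s, 'l::finite) project \<Rightarrow> ('s \<Rightarrow> real) \<Rightarrow> bool" where
  "bellman_solution \<beta> lam p h \<longleftrightarrow>
     bounded_measurable (states p) h \<and>
     (\<forall>x\<in>space (states p). acts p x \<noteq> {} \<and>
        h x = (SUP a\<in>acts p x. rew p x a - lam \<bullet> constr p x a + \<beta> * (\<integral>y. h y \<partial>trans_law p x a)))"

record ('s, 'l) wcdp =
  nproj :: nat
  proj :: "nat \<Rightarrow> ('s, 'l) project"
  bvec :: "real ^ 'l"

definition is_wcdp :: "('s, 'l::finite) wcdp \<Rightarrow> bool" where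
  "is_wcdp W \<longleftrightarrow> 1 \<le> nproj W \<and> (\<forall>n\<in>{1..nproj W}. is_project (proj W n))"

definition joint_states :: "('s, 'l::finite) wcdp \<Rightarrow> (nat \<Rightarrow> 's) measure" where
  "joint_states W = (\<Pi>\<^sub>M n\<in>{1..nproj W}. states (proj W n))"

definition joint_acts :: "('s, 'l::finite) wcdp \<Rightarrow> (nat \<Rightarrow> 's) \<Rightarrow> (nat \<Rightarrow> action) set" where
  "joint_acts W x = (\<Pi>\<^sub>E n\<in>{1..nproj W}. acts (proj W n) (x n))"

definition joint_rew :: "('s, 'l::finite) wcdp \<Rightarrow> (nat \<Rightarrow> 's) \<Rightarrow> (nat \<Rightarrow> action) \<Rightarrow> real" where
  "joint_rew W x a = (\<Sum>n=1..nproj W. rew (proj W n) (x n) (a n))"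

definition joint_constr :: "('s, 'l::finite) wcdp \<Rightarrow> (nat \<Rightarrow> 's) \<Rightarrow> (nat \<Rightarrow> action) \<Rightarrow> real ^ 'l" where
  "joint_constr W x a = (\<Sum>n=1..nproj W. constr (proj W n) (x n) (a n))"

definition joint_acts_bar :: "('s, 'l::finite) wcdp \<Rightarrow> (nat \<Rightarrow> 's) \<Rightarrow> (nat \<Rightarrow> action) set" where
  "joint_acts_bar W x = {a \<in> joint_acts W x. joint_constr W x a \<le> bvec W}"

definition joint_trans :: "('s, 'l::finite) wcdp \<Rightarrow> (nat \<Rightarrow> 's) \<Rightarrow> (nat \<Rightarrow> action) \<Rightarrow> (nat \<Rightarrow> 's) measure" where
  "joint_trans W x a = (\<Pi>\<^sub>M n\<in>{1..nproj W}. trans_law (proj W n) (x n) (a n))"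

definition separable :: "('s, 'l::finite) wcdp \<Rightarrow> real \<Rightarrow> (nat \<Rightarrow> 's \<Rightarrow> real) \<Rightarrow> (nat \<Rightarrow> 's) \<Rightarrow> real" where
  "separable W \<theta> h x = \<theta> + (\<Sum>n=1..nproj W. h n (x n))"

text \<open>
  \<open>state_of S n [a\<^sub>0, \<dots>, a\<^sub>t\<^sub>-\<^sub>1] \<omega>\<close> is the state of project \<open>n\<close> at time \<open>t\<close> in scenario \<open>\<omega>\<close> after the
  controls \<open>a\<^sub>0, \<dots>, a\<^sub>t\<^sub>-\<^sub>1\<close>. The kernel \<open>cond_law S\<close> is a regular conditional distribution of the
  scenario given the initial state, so that the expectation given \<open>x\<^sub>0 = x\<close> is the integral
  against \<open>cond_law S x\<close>.
\<close>

record ('s, 'w) scenarios =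
  scen :: "'w measure"
  state_of :: "nat \<Rightarrow> action list \<Rightarrow> 'w \<Rightarrow> 's"
  cond_law :: "(nat \<Rightarrow> 's) \<Rightarrow> 'w measure"

definition state_at :: "('s, 'w) scenarios \<Rightarrow> nat \<Rightarrow> (nat \<Rightarrow> action) \<Rightarrow> 'w \<Rightarrow> nat \<Rightarrow> 's" where
  "state_at S n a \<omega> t = state_of S n (map a [0..<t]) \<omega>"

definition joint_state_at ::
  "('s, 'l::finite) wcdp \<Rightarrow> ('s, 'w) scenarios \<Rightarrow> (nat \<Rightarrow> nat \<Rightarrow> action) \<Rightarrow> 'w \<Rightarrow> nat \<Rightarrow> (nat \<Rightarrow> 's)" where
  "joint_state_at W S a \<omega> t = (\<lambda>n\<in>{1..nproj W}. state_at S n (\<lambda>s. a s n) \<omega> t)"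

definition initial_state :: "('s, 'l::finite) wcdp \<Rightarrow> ('s, 'w) scenarios \<Rightarrow> 'w \<Rightarrow> (nat \<Rightarrow> 's)" where
  "initial_state W S \<omega> = (\<lambda>n\<in>{1..nproj W}. state_of S n [] \<omega>)"

definition is_scenarios :: "('s, 'l::finite) wcdp \<Rightarrow> ('s, 'w) scenarios \<Rightarrow> bool" where
  "is_scenarios W S \<longleftrightarrow>
     prob_space (scen S) \<and>
     (\<forall>n\<in>{1..nproj W}. \<forall>\<omega>\<in>space (scen S). \<forall>a t.
        (\<forall>s<t. a s \<in> acts (proj W n) (state_at S n a \<omega> s)) \<longrightarrow>
        state_at S n a \<omega> t \<in> space (states (proj W n))) \<and>
     initial_state W S \<in> scen S \<rightarrow>\<^sub>M joint_states W \<and>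
     cond_law S \<in> joint_states W \<rightarrow>\<^sub>M prob_algebra (scen S) \<and>
     (\<forall>E\<in>sets (scen S). AE \<omega> in scen S.
        real_cond_exp (scen S) (vimage_algebra (space (scen S)) (initial_state W S) (joint_states W))
          (indicator E) \<omega> = measure (cond_law S (initial_state W S \<omega>)) E)"

text \<open>
  Control sequences \<open>(a\<^sub>0, \<dots>, a\<^sub>T)\<close> are functions of time in \<open>extensional {..T}\<close>. Joint control
  sequences take the time first and the project second.
\<close>

definition proj_paths ::
  "('s, 'l::finite) wcdp \<Rightarrow> ('s, 'w) scenarios \<Rightarrow> nat \<Rightarrow> 'w \<Rightarrow> nat \<Rightarrow> (nat \<Rightarrow> action) set" where
  "proj_paths W S n \<omega> T =
     {a \<in> extensional {..T}. \<forall>t\<le>T. a t \<in> acts (proj W n) (state_at S n a \<omega> t)}"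

definition joint_paths ::
  "('s, 'l::finite) wcdp \<Rightarrow> ('s, 'w) scenarios \<Rightarrow> 'w \<Rightarrow> nat \<Rightarrow> (nat \<Rightarrow> nat \<Rightarrow> action) set" where
  "joint_paths W S \<omega> T =
     {a \<in> extensional {..T}. \<forall>t\<le>T. a t \<in> joint_acts W (joint_state_at W S a \<omega> t)}"

definition joint_paths_bar ::
  "('s, 'l::finite) wcdp \<Rightarrow> ('s, 'w) scenarios \<Rightarrow> 'w \<Rightarrow> nat \<Rightarrow> (nat \<Rightarrow> nat \<Rightarrow> action) set" where
  "joint_paths_bar W S \<omega> T =
     {a \<in> extensional {..T}. \<forall>t\<le>T. a t \<in> joint_acts_bar W (joint_state_at W S a \<omega> t)}"

definition info_payoff ::
  "real \<Rightarrow> ('s, 'l::finite) wcdp \<Rightarrow> ('s, 'w) scenarios \<Rightarrow> ((nat \<Rightarrow> 's) \<Rightarrow> real) \<Rightarrow>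
   (nat \<Rightarrow> nat \<Rightarrow> action) \<Rightarrow> 'w \<Rightarrow> nat \<Rightarrow> (nat \<Rightarrow> real ^ 'l) \<Rightarrow> real" where
  "info_payoff \<beta> W S H a \<omega> T \<mu> =
     (\<Sum>t\<le>T. let x = joint_state_at W S a \<omega> t in
        joint_rew W x (a t) + \<beta> * (\<integral>y. H y \<partial>joint_trans W x (a t)) - H x
        + \<mu> t \<bullet> (bvec W - joint_constr W x (a t)))"

text \<open>
  Suprema and infima are taken in the reals. Below they only occur where the assumptions make the
  respective sets nonempty and bounded.
\<close>

definition primal_value ::
  "real \<Rightarrow> ('s, 'l::finite) wcdp \<Rightarrow> ('s, 'w) scenarios \<Rightarrow> ((nat \<Rightarrow> 's) \<Rightarrow> real) \<Rightarrow> 'w \<Rightarrow> nat \<Rightarrow> real" where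
  "primal_value \<beta> W S H \<omega> T = (SUP a\<in>joint_paths_bar W S \<omega> T. info_payoff \<beta> W S H a \<omega> T (\<lambda>_. 0))"

definition dual_value ::
  "real \<Rightarrow> ('s, 'l::finite) wcdp \<Rightarrow> ('s, 'w) scenarios \<Rightarrow> ((nat \<Rightarrow> 's) \<Rightarrow> real) \<Rightarrow> 'w \<Rightarrow> nat \<Rightarrow> real" where
  "dual_value \<beta> W S H \<omega> T =
     (INF \<mu>\<in>{\<mu>. \<forall>t\<le>T. 0 \<le> \<mu> t}. SUP a\<in>joint_paths W S \<omega> T. info_payoff \<beta> W S H a \<omega> T \<mu>)"

text \<open>
  \<open>geometric_pmf (1 - \<beta>)\<close> gives the random time \<open>t\<close> the mass \<open>(1 - \<beta>) * \<beta> ^ t\<close>; independence of the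
  scenario is the product measure.
\<close>

definition L_bound ::
  "real \<Rightarrow> ('s, 'l::finite) wcdp \<Rightarrow> ('s, 'w) scenarios \<Rightarrow> ((nat \<Rightarrow> 's) \<Rightarrow> real) \<Rightarrow> (nat \<Rightarrow> 's) \<Rightarrow> real" where
  "L_bound \<beta> W S H x =
     H x + (\<integral>(\<omega>, T). primal_value \<beta> W S H \<omega> T \<partial>(cond_law S x \<Otimes>\<^sub>M measure_pmf (geometric_pmf (1 - \<beta>))))"

definition L_circ_bound ::
  "real \<Rightarrow> ('s, 'l::finite) wcdp \<Rightarrow> ('s, 'w) scenarios \<Rightarrow> ((nat \<Rightarrow> 's) \<Rightarrow> real) \<Rightarrow> (nat \<Rightarrow> 's) \<Rightarrow> real" where
  "L_circ_bound \<beta> W S H x =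
     H x + (\<integral>(\<omega>, T). dual_value \<beta> W S H \<omega> T \<partial>(cond_law S x \<Otimes>\<^sub>M measure_pmf (geometric_pmf (1 - \<beta>))))"

definition values_measurable ::
  "real \<Rightarrow> ('s, 'l::finite) wcdp \<Rightarrow> ('s, 'w) scenarios \<Rightarrow> ((nat \<Rightarrow> 's) \<Rightarrow> real) \<Rightarrow> bool" where
  "values_measurable \<beta> W S H \<longleftrightarrow>
     (\<forall>T. (\<lambda>\<omega>. primal_value \<beta> W S H \<omega> T) \<in> borel_measurable (scen S) \<and>
          (\<lambda>\<omega>. dual_value \<beta> W S H \<omega> T) \<in> borel_measurable (scen S))"

definition proj_constr ::
  "('s, 'l::finite) wcdp \<Rightarrow> ('s, 'w) scenarios \<Rightarrow> nat \<Rightarrow> nat \<Rightarrow> (nat \<Rightarrow> action) \<Rightarrow> 'w \<Rightarrow> real ^ 'l" where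
  "proj_constr W S n t a \<omega> = constr (proj W n) (state_at S n a \<omega> t) (a t)"

definition proj_payoff ::
  "real \<Rightarrow> ('s, 'l::finite) wcdp \<Rightarrow> ('s, 'w) scenarios \<Rightarrow> nat \<Rightarrow> ('s \<Rightarrow> real) \<Rightarrow> (nat \<Rightarrow> action) \<Rightarrow>
   'w \<Rightarrow> nat \<Rightarrow> real" where
  "proj_payoff \<beta> W S n h a \<omega> T = (\<Sum>t\<le>T. stage_gain \<beta> (proj W n) h (state_at S n a \<omega> t) (a t))"

definition assumption1 :: "('s, 'l::finite) wcdp \<Rightarrow> bool" where
  "assumption1 W \<longleftrightarrow> (\<forall>x\<in>space (joint_states W). joint_acts_bar W x \<noteq> {})"

definition assumption2 ::
  "real \<Rightarrow> ('s, 'l::finite) wcdp \<Rightarrow> ('s, 'w) scenarios \<Rightarrow> (nat \<Rightarrow> 's \<Rightarrow> real) \<Rightarrow> 'w \<Rightarrow> nat \<Rightarrow> bool" where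
  "assumption2 \<beta> W S h \<omega> T \<longleftrightarrow>
     (\<forall>n\<in>{1..nproj W}.
        let Z = (\<lambda>a. (a, \<lambda>t\<in>{..T}. proj_constr W S n t a \<omega>, proj_payoff \<beta> W S n (h n) a \<omega> T))
                  ` proj_paths W S n \<omega> T
        in Z \<noteq> {} \<and> compact Z)"

text \<open>
  The representations of \<open>c\<close> as a finite convex combination of members of \<open>A\<close>; \<open>c\<close> lies in the
  convex hull of \<open>A\<close> iff there is one. (Functions are not an instance of \<open>real_vector\<close>.)
\<close>

definition convex_reps ::
  "(nat \<Rightarrow> action) set \<Rightarrow> (nat \<Rightarrow> action) \<Rightarrow> (nat \<times> (nat \<Rightarrow> real) \<times> (nat \<Rightarrow> nat \<Rightarrow> action)) set" where
  "convex_reps A c =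
     {(m, q, d). (\<forall>k<m. 0 \<le> q k \<and> d k \<in> A) \<and> (\<Sum>k<m. q k) = 1 \<and>
                 c = (\<lambda>t i. \<Sum>k<m. q k * d k t i)}"

definition conv_paths :: "(nat \<Rightarrow> action) set \<Rightarrow> (nat \<Rightarrow> action) set" where
  "conv_paths A = {c. convex_reps A c \<noteq> {}}"

definition cl_constr ::
  "('s, 'l::finite) wcdp \<Rightarrow> ('s, 'w) scenarios \<Rightarrow> nat \<Rightarrow> nat \<Rightarrow> nat \<Rightarrow> (nat \<Rightarrow> action) \<Rightarrow> 'w \<Rightarrow> real ^ 'l" where
  "cl_constr W S n T t c \<omega> =
     (\<chi> l. INF (m, q, d)\<in>convex_reps (proj_paths W S n \<omega> T) c.
              \<Sum>k<m. q k * proj_constr W S n t (d k) \<omega> $ l)"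

definition assumption3 :: "('s, 'l::finite) wcdp \<Rightarrow> ('s, 'w) scenarios \<Rightarrow> 'w \<Rightarrow> nat \<Rightarrow> bool" where
  "assumption3 W S \<omega> T \<longleftrightarrow>
     (\<forall>n\<in>{1..nproj W}. \<forall>c\<in>conv_paths (proj_paths W S n \<omega> T).
        \<exists>a\<in>proj_paths W S n \<omega> T. \<forall>t\<le>T. proj_constr W S n t a \<omega> \<le> cl_constr W S n T t c \<omega>)"

end

theory Submission
  imports Defs
begin

text \<open>
  Part (a). For a fixed scenario and horizon \<open>T\<close> the primal problem chooses one path per project so
  as to maximise a sum of \<open>N\<close> payoffs under \<open>m = (T + 1) * CARD('l)\<close> linking constraints, and the dual
  value is its Lagrangian relaxation. Two facts make the duality gap independent of \<open>N\<close>. The dual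
  value is the optimal value of the problem in which every project may take convex combinations of
  its outcomes (\<open>gordan_alternative\<close>). By the Shapley-Folkman principle, a point of a sum of \<open>N\<close> convex
  hulls in dimension \<open>m + 1\<close> (the constraints and the objective) needs a proper convex combination in
  at most \<open>m + 1\<close> of the summands (\<open>shapley_folkman\<close>). Assumption 3 replaces such a combination by a
  genuine path that uses no more of the resources, and a project loses at most \<open>(T + 1) * K\<close>, because
  stage gains differ by at most \<open>Gam \<le> K\<close>. Hence the gap is at most \<open>(m + 1) * (T + 1) * K\<close>
  (\<open>dual_le_primal\<close>). This is quadratic in \<open>T\<close>, and a geometric time has a finite second moment, so
  the expected gap is bounded by a constant made of \<open>K\<close>, \<open>CARD('l)\<close> and \<open>\<beta>\<close> only
  (\<open>abs_bound_difference_le\<close>).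

  Minima over convexified problems need not be known to exist: the convexified problem is solved up
  to any \<open>\<epsilon> > 0\<close>, rounded, and compactness of the sets of genuine outcomes (Assumption 2) then lets
  \<open>\<epsilon>\<close> tend to zero (\<open>compact_sums_limit\<close>).

  Part (b). The Bellman operator is a \<open>\<beta>\<close>-contraction with one-stage reward in \<open>[- C, C]\<close>, so its
  bounded solution lies in \<open>[- C / (1 - \<beta>), C / (1 - \<beta>)]\<close>; a stage gain is therefore at most
  \<open>C + (1 + \<beta>) * C / (1 - \<beta>) = 2 * C / (1 - \<beta>)\<close> in absolute value.
\<close>

section \<open>Basic solutions of linear systems\<close>

text \<open>
  The dimension \<open>m + 1\<close> varies with the horizon, so vectors are functions on an index set that is
  restricted to a finite set where needed, and the required linear algebra is done on such functions.
\<close>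

lemma homogeneous_system_nontrivial_solution:
  fixes A :: "'e \<Rightarrow> 'x \<Rightarrow> real"
  assumes "finite E" "finite X" "card E < card X"
  shows "\<exists>c. (\<exists>x\<in>X. c x \<noteq> 0) \<and> (\<forall>e\<in>E. (\<Sum>x\<in>X. A e x * c x) = 0)"
  using assms
proof (induction E arbitrary: X A rule: finite_induct)
  case empty
  then have "X \<noteq> {}" by auto
  then show ?case by (intro exI[of _ "\<lambda>_. 1"]) auto
next
  case (insert e E)
  show ?case
  proof (cases "\<forall>x\<in>X. A e x = 0")
    case True
    have "card E < card X" using insert by simp
    then obtain c where "\<exists>x\<in>X. c x \<noteq> 0" "\<forall>e\<in>E. (\<Sum>x\<in>X. A e x * c x) = 0"
      using insert.IH[of X A] insert.prems by blast
    then show ?thesis using True by (intro exI[of _ c]) auto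
  next
    case False
    then obtain p where p: "p \<in> X" "A e p \<noteq> 0" by blast
    define A' where "A' = (\<lambda>e' x. A e' x - A e' p * A e x / A e p)"
    have "card E < card (X - {p})" using insert p by simp
    then obtain c where c: "\<exists>x\<in>X - {p}. c x \<noteq> 0"
        "\<forall>e'\<in>E. (\<Sum>x\<in>X - {p}. A' e' x * c x) = 0"
      using insert.IH[of "X - {p}" A'] insert.prems by blast
    define s where "s = (\<Sum>x\<in>X - {p}. A e x * c x)"
    define c' where "c' = c(p := - s / A e p)"
    have sum_c': "(\<Sum>x\<in>X. A e' x * c' x) = (\<Sum>x\<in>X - {p}. A e' x * c x) - A e' p * s / A e p" for e'
    proof -
      have "(\<Sum>x\<in>X. A e' x * c' x) = A e' p * c' p + (\<Sum>x\<in>X - {p}. A e' x * c' x)"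
        using insert.prems p by (simp add: sum.remove)
      also have "(\<Sum>x\<in>X - {p}. A e' x * c' x) = (\<Sum>x\<in>X - {p}. A e' x * c x)"
        by (intro sum.cong) (auto simp: c'_def)
      finally show ?thesis by (simp add: c'_def)
    qed
    have "(\<Sum>x\<in>X. A e' x * c' x) = (\<Sum>x\<in>X - {p}. A' e' x * c x)" for e'
      unfolding sum_c' A'_def s_def
      by (simp add: left_diff_distrib sum_subtractf sum_distrib_left sum_divide_distrib mult.assoc)
    then have "\<forall>e'\<in>E. (\<Sum>x\<in>X. A e' x * c' x) = 0" using c(2) by simp
    moreover have "(\<Sum>x\<in>X. A e x * c' x) = 0"
      using sum_c'[of e] p(2) by (simp add: s_def)
    moreover have "\<exists>x\<in>X. c' x \<noteq> 0" using c(1) by (auto simp: c'_def)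
    ultimately show ?thesis by blast
  qed
qed

text \<open>
  The conic form of Caratheodory's theorem: while the support has more elements than there are
  equations, the solution can be moved along a kernel vector until one more coordinate vanishes.
\<close>

lemma basic_nonneg_solution:
  fixes A :: "'e \<Rightarrow> 'x \<Rightarrow> real"
  assumes "finite E" "finite X" "\<And>x. x \<in> X \<Longrightarrow> 0 \<le> q x"
  shows "\<exists>X' p. X' \<subseteq> X \<and> card X' \<le> card E \<and> (\<forall>x\<in>X'. 0 < p x) \<and>
           (\<forall>e\<in>E. (\<Sum>x\<in>X'. A e x * p x) = (\<Sum>x\<in>X. A e x * q x))"
  using assms(2,3)
proof (induction "card X" arbitrary: X q rule: less_induct)
  case less
  have drop: ?case if "z \<in> X" "q' z = 0" "\<And>x. x \<in> X \<Longrightarrow> 0 \<le> q' x"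
      "\<forall>e\<in>E. (\<Sum>x\<in>X. A e x * q' x) = (\<Sum>x\<in>X. A e x * q x)" for z q'
  proof -
    have lt: "card (X - {z}) < card X"
      using that(1) less.prems(1) by (rule card_Diff1_less[rotated])
    have "\<exists>X' p. X' \<subseteq> X - {z} \<and> card X' \<le> card E \<and> (\<forall>x\<in>X'. 0 < p x) \<and>
           (\<forall>e\<in>E. (\<Sum>x\<in>X'. A e x * p x) = (\<Sum>x\<in>X - {z}. A e x * q' x))"
      by (rule less.hyps[OF lt]) (use less.prems that in auto)
    then obtain X' p where *: "X' \<subseteq> X - {z}" "card X' \<le> card E" "\<forall>x\<in>X'. 0 < p x"
        "\<forall>e\<in>E. (\<Sum>x\<in>X'. A e x * p x) = (\<Sum>x\<in>X - {z}. A e x * q' x)"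
      by blast
    have "(\<Sum>x\<in>X - {z}. A e x * q' x) = (\<Sum>x\<in>X. A e x * q' x)" for e
      using that(1,2) less.prems(1) by (simp add: sum.remove[of X z])
    then show ?thesis using * that(4) by (intro exI[of _ X'] exI[of _ p]) auto
  qed
  show ?case
  proof (cases "card X \<le> card E")
    case True
    show ?thesis
    proof (cases "\<forall>x\<in>X. 0 < q x")
      case True
      then show ?thesis using \<open>card X \<le> card E\<close> by blast
    next
      case False
      then obtain z where "z \<in> X" "q z = 0" using less.prems(2) by force
      then show ?thesis using drop[of z q] less.prems(2) by blast
    qed
  next
    case False
    then obtain c0 where c0: "\<exists>x\<in>X. c0 x \<noteq> 0" "\<forall>e\<in>E. (\<Sum>x\<in>X. A e x * c0 x) = 0"
      using homogeneous_system_nontrivial_solution[of E X A] assms(1) less.prems(1)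
      by (auto simp: not_le)
    obtain c where c: "\<exists>x\<in>X. 0 < c x" "\<forall>e\<in>E. (\<Sum>x\<in>X. A e x * c x) = 0"
    proof (cases "\<exists>x\<in>X. 0 < c0 x")
      case True
      then show ?thesis using that c0 by blast
    next
      case False
      then have "\<exists>x\<in>X. 0 < - c0 x" using c0(1) by force
      then show ?thesis using that[of "\<lambda>x. - c0 x"] c0(2) by (simp add: sum_negf)
    qed
    define P where "P = {x\<in>X. 0 < c x}"
    have P: "finite P" "P \<noteq> {}" using less.prems(1) c(1) by (auto simp: P_def)
    obtain z where z: "z \<in> P" "\<And>x. x \<in> P \<Longrightarrow> q z / c z \<le> q x / c x"
      using ex_min_if_finite[of "(\<lambda>x. q x / c x) ` P"] P by (force simp: not_less)
    define t where "t = q z / c z"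
    have t: "0 \<le> t" using z(1) less.prems(2) by (auto simp: t_def P_def)
    show ?thesis
    proof (rule drop[of z "\<lambda>x. q x - t * c x"])
      show "z \<in> X" "q z - t * c z = 0" using z(1) by (auto simp: P_def t_def)
    next
      fix x assume x: "x \<in> X"
      show "0 \<le> q x - t * c x"
      proof (cases "0 < c x")
        case True
        then have "t \<le> q x / c x" using z(2) x by (auto simp: P_def t_def)
        then show ?thesis using True by (simp add: pos_le_divide_eq)
      next
        case False
        then have "t * c x \<le> 0" using t by (simp add: mult_nonneg_nonpos)
        then show ?thesis using less.prems(2)[OF x] by linarith
      qed
    next
      have "(\<Sum>x\<in>X. A e x * (q x - t * c x)) = (\<Sum>x\<in>X. A e x * q x) - t * (\<Sum>x\<in>X. A e x * c x)" for e
        by (simp add: right_diff_distrib sum_subtractf sum_distrib_left mult.left_commute)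
      then show "\<forall>e\<in>E. (\<Sum>x\<in>X. A e x * (q x - t * c x)) = (\<Sum>x\<in>X. A e x * q x)"
        using c(2) by simp
    qed
  qed
qed

section \<open>The Shapley-Folkman theorem\<close>

text \<open>
  The weights on pairs (summand, point) solve one equation per summand, saying that its weights add
  up to one, and one equation per coordinate. A basic solution has at most \<open>card I + card J\<close> positive
  weights. Each summand needs one of them, so at most \<open>card J\<close> summands have more than one. All
  summands start from the same weights \<open>q\<close>, since the convex hull of a sum is contained in the sum of
  the convex hulls.
\<close>

lemma shapley_folkman:
  fixes y :: "'n \<Rightarrow> 'd \<Rightarrow> 'j \<Rightarrow> real"
  assumes I: "finite I" and J: "finite J" and F: "finite F"
    and q: "\<forall>d\<in>F. 0 \<le> q d" "(\<Sum>d\<in>F. q d) = 1"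
  shows "\<exists>S p. (\<forall>n\<in>I. S n \<subseteq> F \<and> (\<forall>d\<in>S n. 0 < p n d) \<and> (\<Sum>d\<in>S n. p n d) = 1) \<and>
           card {n\<in>I. \<not> is_singleton (S n)} \<le> card J \<and>
           (\<forall>j\<in>J. (\<Sum>n\<in>I. \<Sum>d\<in>S n. p n d * y n d j) = (\<Sum>d\<in>F. q d * (\<Sum>n\<in>I. y n d j)))"
proof -
  define A :: "'n + 'j \<Rightarrow> 'n \<times> 'd \<Rightarrow> real" where
    "A = (\<lambda>e (n, d). case e of Inl n' \<Rightarrow> of_bool (n = n') | Inr j \<Rightarrow> y n d j)"
  obtain X p where X: "X \<subseteq> I \<times> F" "card X \<le> card (I <+> J)" "\<forall>x\<in>X. 0 < p x"
      "\<forall>e\<in>I <+> J. (\<Sum>x\<in>X. A e x * p x) = (\<Sum>x\<in>I \<times> F. A e x * q (snd x))"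
    using basic_nonneg_solution[of "I <+> J" "I \<times> F" "\<lambda>x. q (snd x)" A] I J F q(1) by auto
  define S where "S n = {d. (n, d) \<in> X}" for n
  have S: "S n \<subseteq> F" "finite (S n)" for n
    using X(1) F by (auto simp: S_def intro: finite_subset[of _ F])
  have X_eq: "X = Sigma I S" using X(1) by (auto simp: S_def)
  have one: "(\<Sum>d\<in>S n. p (n, d)) = 1" if n: "n \<in> I" for n
  proof -
    have "(\<Sum>x\<in>X. A (Inl n) x * p x) = (\<Sum>m\<in>I. \<Sum>d\<in>S m. A (Inl n) (m, d) * p (m, d))"
      unfolding X_eq using I S by (subst sum.Sigma) auto
    also have "\<dots> = (\<Sum>m\<in>I. if m = n then \<Sum>d\<in>S m. p (m, d) else 0)"
      by (intro sum.cong) (auto simp: A_def)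
    also have "\<dots> = (\<Sum>d\<in>S n. p (n, d))" using n I by simp
    finally have 1: "(\<Sum>x\<in>X. A (Inl n) x * p x) = (\<Sum>d\<in>S n. p (n, d))" .
    have "(\<Sum>x\<in>I \<times> F. A (Inl n) x * q (snd x)) = (\<Sum>m\<in>I. \<Sum>d\<in>F. A (Inl n) (m, d) * q d)"
      by (subst sum.cartesian_product) (auto intro: sum.cong)
    also have "\<dots> = (\<Sum>m\<in>I. if m = n then \<Sum>d\<in>F. q d else 0)"
      by (intro sum.cong) (auto simp: A_def)
    also have "\<dots> = 1" using n I q(2) by simp
    finally show ?thesis using 1 X(4)[rule_format, OF InlI[OF n]] by simp
  qed
  have sums: "(\<Sum>n\<in>I. \<Sum>d\<in>S n. p (n, d) * y n d j) = (\<Sum>d\<in>F. q d * (\<Sum>n\<in>I. y n d j))"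
    if j: "j \<in> J" for j
  proof -
    have "(\<Sum>n\<in>I. \<Sum>d\<in>S n. p (n, d) * y n d j) = (\<Sum>x\<in>X. A (Inr j) x * p x)"
      unfolding X_eq using I S by (subst sum.Sigma) (auto simp: A_def intro!: sum.cong)
    also have "\<dots> = (\<Sum>x\<in>I \<times> F. A (Inr j) x * q (snd x))" using X(4) j by blast
    also have "\<dots> = (\<Sum>n\<in>I. \<Sum>d\<in>F. q d * y n d j)"
      by (subst sum.cartesian_product) (auto simp: A_def intro!: sum.cong)
    also have "\<dots> = (\<Sum>d\<in>F. q d * (\<Sum>n\<in>I. y n d j))"
      by (subst sum.swap) (simp add: sum_distrib_left)
    finally show ?thesis .
  qed
  define M where "M = {n\<in>I. \<not> is_singleton (S n)}"
  have "card M = (\<Sum>n\<in>I. of_bool (\<not> is_singleton (S n)))"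
    unfolding M_def card_eq_sum of_bool_def by (rule sum.inter_filter[OF I])
  then have "card I + card M = (\<Sum>n\<in>I. 1 + of_bool (\<not> is_singleton (S n)))"
    by (simp add: sum_Suc)
  also have "\<dots> \<le> (\<Sum>n\<in>I. card (S n))"
  proof (rule sum_mono)
    fix n assume n: "n \<in> I"
    have "S n \<noteq> {}" using one[OF n] by auto
    then have "card (S n) \<noteq> 0" using S(2) by simp
    then show "1 + of_bool (\<not> is_singleton (S n)) \<le> card (S n)"
      by (cases "is_singleton (S n)") (auto simp: is_singleton_altdef)
  qed
  also have "\<dots> = card X" unfolding X_eq using I S by simp
  also have "\<dots> \<le> card I + card J" using X(2) I J by (simp add: card_Plus)
  finally have "card M \<le> card J" by simp
  then show ?thesis
    using S(1) X(3) one sums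
    by (intro exI[of _ S] exI[of _ "\<lambda>n d. p (n, d)"]) (auto simp: M_def S_def)
qed

section \<open>A theorem of the alternative\<close>

text \<open>
  If no nonnegative \<open>\<mu>\<close> is positive on all points, then some convex combination of the points is almost
  nonpositive. The proof minimises the squared distance \<open>\<phi>\<close> to the nonpositive orthant over the convex
  hull; were its infimum \<open>\<delta>\<close> positive, the positive part \<open>\<mu>\<close> of a near-minimiser \<open>u\<close> would separate:
  moving a small step \<open>t\<close> from \<open>u\<close> towards a point cannot decrease \<open>\<phi>\<close> below \<open>\<delta>\<close>.
\<close>

lemma gordan_alternative:
  fixes y :: "'d \<Rightarrow> 'j \<Rightarrow> real"
  assumes J: "finite J" and D: "D \<noteq> {}" and M: "\<And>d j. d \<in> D \<Longrightarrow> j \<in> J \<Longrightarrow> \<bar>y d j\<bar> \<le> M"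
    and nosep: "\<And>\<mu>. (\<And>j. 0 \<le> \<mu> j) \<Longrightarrow> \<exists>d\<in>D. (\<Sum>j\<in>J. \<mu> j * y d j) \<le> 0"
    and \<epsilon>: "0 < \<epsilon>"
  shows "\<exists>F q. finite F \<and> F \<subseteq> D \<and> (\<forall>d\<in>F. 0 \<le> q d) \<and> (\<Sum>d\<in>F. q d) = 1 \<and>
           (\<forall>j\<in>J. (\<Sum>d\<in>F. q d * y d j) \<le> \<epsilon>)"
proof (rule ccontr)
  assume contr: "\<not> ?thesis"
  define U where "U = {u. \<exists>F q. finite F \<and> F \<subseteq> D \<and> (\<forall>d\<in>F. 0 \<le> q d) \<and> (\<Sum>d\<in>F. q d) = 1 \<and>
      u = (\<lambda>j. \<Sum>d\<in>F. q d * y d j)}"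
  define \<phi> where "\<phi> u = (\<Sum>j\<in>J. (max 0 (u j))\<^sup>2)" for u :: "'j \<Rightarrow> real"
  have U_ne: "U \<noteq> {}"
  proof -
    obtain d where "d \<in> D" using D by blast
    then have "(\<lambda>j. \<Sum>d\<in>{d}. 1 * y d j) \<in> U"
      unfolding U_def by (intro CollectI exI[of _ "{d}"] exI[of _ "\<lambda>_. 1"]) auto
    then show ?thesis by blast
  qed
  have U_bound: "\<bar>u j\<bar> \<le> M" if "u \<in> U" "j \<in> J" for u j
  proof -
    obtain F q where F: "finite F" "F \<subseteq> D" "\<forall>d\<in>F. 0 \<le> q d" "(\<Sum>d\<in>F. q d) = 1"
        "u = (\<lambda>j. \<Sum>d\<in>F. q d * y d j)"
      using \<open>u \<in> U\<close> by (auto simp: U_def)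
    have "\<bar>u j\<bar> \<le> (\<Sum>d\<in>F. \<bar>q d * y d j\<bar>)" unfolding F(5) by (rule sum_abs)
    also have "\<dots> \<le> (\<Sum>d\<in>F. q d * M)"
      using F M[OF _ \<open>j \<in> J\<close>] by (intro sum_mono) (auto simp: abs_mult intro!: mult_left_mono)
    also have "\<dots> = M" using F(4) by (simp flip: sum_distrib_right)
    finally show ?thesis .
  qed
  have U_step: "(\<lambda>j. (1 - t) * u j + t * y d j) \<in> U" if u: "u \<in> U" and d: "d \<in> D" and t: "0 \<le> t" "t \<le> 1"
    for u d t
  proof -
    obtain F q where F: "finite F" "F \<subseteq> D" "\<forall>d\<in>F. 0 \<le> q d" "(\<Sum>d\<in>F. q d) = 1"
        "u = (\<lambda>j. \<Sum>d\<in>F. q d * y d j)"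
      using u by (auto simp: U_def)
    define q' where "q' e = (1 - t) * (if e \<in> F then q e else 0) + t * of_bool (e = d)" for e
    have sum_q': "(\<Sum>e\<in>insert d F. q' e * g e) = (1 - t) * (\<Sum>e\<in>F. q e * g e) + t * g d" for g
    proof -
      have "(\<Sum>e\<in>insert d F. (if e \<in> F then q e else 0) * g e) = (\<Sum>e\<in>F. q e * g e)"
        using F(1) by (intro sum.mono_neutral_cong_right) auto
      moreover have "(\<Sum>e\<in>insert d F. of_bool (e = d) * g e) = g d"
        using F(1) by (simp add: of_bool_def if_distrib[of "\<lambda>x. x * _"] cong: if_cong)
      ultimately show ?thesis
        by (simp add: q'_def distrib_right sum.distrib mult.assoc flip: sum_distrib_left del: sum.insert sum.insert_if)
    qed
    have "(\<Sum>e\<in>insert d F. q' e) = 1" using sum_q'[of "\<lambda>_. 1"] F(4) by simp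
    moreover have "\<forall>e\<in>insert d F. 0 \<le> q' e" using F(3) t by (auto simp: q'_def)
    ultimately show ?thesis
      unfolding U_def using sum_q'[of "\<lambda>e. y e _"] F d
      by (intro CollectI exI[of _ "insert d F"] exI[of _ q']) (auto simp: fun_eq_iff)
  qed
  have \<phi>_bdd: "bdd_below (\<phi> ` U)"
    by (intro bdd_belowI2[of _ 0]) (simp add: \<phi>_def sum_nonneg)
  define \<delta> where "\<delta> = (INF u\<in>U. \<phi> u)"
  have "\<epsilon>\<^sup>2 \<le> \<phi> u" if u: "u \<in> U" for u
  proof -
    obtain F q where F: "finite F \<and> F \<subseteq> D \<and> (\<forall>d\<in>F. 0 \<le> q d) \<and> (\<Sum>d\<in>F. q d) = 1"
        "u = (\<lambda>j. \<Sum>d\<in>F. q d * y d j)"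
      using u by (auto simp: U_def)
    then have "\<not> (\<forall>j\<in>J. u j \<le> \<epsilon>)" using contr by blast
    then obtain j where j: "j \<in> J" "\<epsilon> < u j" by (auto simp: not_le)
    have "\<epsilon>\<^sup>2 \<le> (max 0 (u j))\<^sup>2" using j \<epsilon> by (intro power_mono) auto
    also have "\<dots> \<le> \<phi> u" unfolding \<phi>_def using j J by (intro member_le_sum) auto
    finally show ?thesis .
  qed
  then have "\<epsilon>\<^sup>2 \<le> \<delta>" unfolding \<delta>_def using U_ne by (intro cINF_greatest) auto
  then have \<delta>: "0 < \<delta>" using \<epsilon> by (smt (verit) zero_less_power)
  \<comment> \<open>\<open>K\<close> bounds the second-order term of \<open>\<phi>\<close> along a step; \<open>t\<close> is so small that this term is at most a quarter of \<open>t * \<delta>\<close>.\<close>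
  define K where "K = (2 * M)\<^sup>2 * card J + 1"
  have K: "0 < K" unfolding K_def by (simp add: add_nonneg_pos)
  define t where "t = min 1 (\<delta> / (4 * K))"
  have t: "0 < t" "t \<le> 1" "t * K \<le> \<delta> / 4"
    using \<delta> K by (auto simp: t_def min_def field_simps)
  obtain u where u: "u \<in> U" "\<phi> u < \<delta> + t * (\<delta> / 4)"
    using cINF_less_iff[OF U_ne \<phi>_bdd, of "\<delta> + t * (\<delta> / 4)"] t \<delta> unfolding \<delta>_def[symmetric] by auto
  define \<mu> where "\<mu> j = max 0 (u j)" for j
  obtain d where d: "d \<in> D" "(\<Sum>j\<in>J. \<mu> j * y d j) \<le> 0"
    using nosep[of \<mu>] by (auto simp: \<mu>_def)
  have "\<delta> \<le> \<phi> (\<lambda>j. (1 - t) * u j + t * y d j)"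
    unfolding \<delta>_def using U_step[OF u(1) d(1)] t \<phi>_bdd by (intro cINF_lower) auto
  also have "\<dots> \<le> (\<Sum>j\<in>J. (\<mu> j)\<^sup>2 + 2 * t * (\<mu> j * (y d j - u j)) + t\<^sup>2 * (2 * M)\<^sup>2)"
    unfolding \<phi>_def
  proof (rule sum_mono)
    fix j assume j: "j \<in> J"
    define w where "w = t * (y d j - u j)"
    have "\<bar>y d j - u j\<bar> \<le> 2 * M" using M[OF d(1) j] U_bound[OF u(1) j] by linarith
    then have "(y d j - u j)\<^sup>2 \<le> (2 * M)\<^sup>2" using power_mono[of "\<bar>y d j - u j\<bar>" "2 * M" 2] by simp
    then have w: "w\<^sup>2 \<le> t\<^sup>2 * (2 * M)\<^sup>2" by (simp add: w_def power_mult_distrib mult_left_mono)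
    \<comment> \<open>Taylor bound for the squared positive part, whose derivative is twice the positive part.\<close>
    have "\<bar>max 0 (u j + w)\<bar> \<le> \<bar>\<mu> j + w\<bar> \<or> u j < 0 \<and> \<bar>max 0 (u j + w)\<bar> \<le> \<bar>w\<bar>"
      by (auto simp: \<mu>_def)
    then have "(max 0 (u j + w))\<^sup>2 \<le> (\<mu> j)\<^sup>2 + 2 * (\<mu> j * w) + w\<^sup>2"
    proof
      assume "\<bar>max 0 (u j + w)\<bar> \<le> \<bar>\<mu> j + w\<bar>"
      then have "(max 0 (u j + w))\<^sup>2 \<le> (\<mu> j + w)\<^sup>2" by (simp only: abs_le_square_iff)
      then show ?thesis by (simp add: power2_sum)
    next
      assume *: "u j < 0 \<and> \<bar>max 0 (u j + w)\<bar> \<le> \<bar>w\<bar>"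
      then have "(max 0 (u j + w))\<^sup>2 \<le> w\<^sup>2" using abs_le_square_iff by blast
      then show ?thesis using * by (simp add: \<mu>_def)
    qed
    also have "u j + w = (1 - t) * u j + t * y d j" by (simp add: w_def algebra_simps)
    finally show "(max 0 ((1 - t) * u j + t * y d j))\<^sup>2
        \<le> (\<mu> j)\<^sup>2 + 2 * t * (\<mu> j * (y d j - u j)) + t\<^sup>2 * (2 * M)\<^sup>2"
      using w by (simp add: w_def algebra_simps)
  qed
  also have "\<dots> = \<phi> u + 2 * t * (\<Sum>j\<in>J. \<mu> j * (y d j - u j)) + t\<^sup>2 * ((2 * M)\<^sup>2 * card J)"
    by (simp add: sum.distrib sum_distrib_left \<phi>_def \<mu>_def mult.assoc)
  also have "(\<Sum>j\<in>J. \<mu> j * (y d j - u j)) = (\<Sum>j\<in>J. \<mu> j * y d j) - \<phi> u"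
  proof -
    have "\<mu> j * (y d j - u j) = \<mu> j * y d j - (max 0 (u j))\<^sup>2" for j
      by (auto simp: \<mu>_def max_def power2_eq_square algebra_simps)
    then show ?thesis by (simp add: sum_subtractf \<phi>_def)
  qed
  also have "\<phi> u + 2 * t * ((\<Sum>j\<in>J. \<mu> j * y d j) - \<phi> u) + t\<^sup>2 * ((2 * M)\<^sup>2 * card J)
      \<le> \<phi> u - 2 * t * \<phi> u + t * (t * K)"
  proof -
    have "t * (\<Sum>j\<in>J. \<mu> j * y d j) \<le> 0" using t d by (simp add: mult_nonneg_nonpos)
    moreover have "t\<^sup>2 * ((2 * M)\<^sup>2 * card J) \<le> t * (t * K)"
      unfolding K_def power2_eq_square[of t] mult.assoc using t by (intro mult_left_mono) auto
    ultimately show ?thesis by (simp add: algebra_simps)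
  qed
  also have "\<dots> \<le> \<phi> u - 2 * t * \<delta> + t * (\<delta> / 4)"
  proof -
    have "\<delta> \<le> \<phi> u" unfolding \<delta>_def using u(1) \<phi>_bdd by (rule cINF_lower[rotated])
    then have "t * \<delta> \<le> t * \<phi> u" using t by simp
    moreover have "t * (t * K) \<le> t * (\<delta> / 4)" using t by (intro mult_left_mono) auto
    ultimately show ?thesis by linarith
  qed
  also have "\<dots> < \<delta>"
  proof -
    have "0 < t * \<delta>" using t \<delta> by simp
    then show ?thesis using u(2) by (simp add: algebra_simps)
  qed
  finally show False by simp
qed

section \<open>Rounding an approximately optimal convexified solution\<close>

text \<open>
  The total violation \<open>\<psi>\<close> of the inequalities is continuous on the product of the compact sets, so it
  attains its infimum, which is zero.
\<close>

lemma compact_sums_limit: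
  fixes Y :: "'n \<Rightarrow> ('j \<Rightarrow> real) set"
  assumes I: "finite I" and J: "finite J" and Y: "\<And>n. n \<in> I \<Longrightarrow> compact (Y n)"
    and approx: "\<And>\<epsilon>. 0 < \<epsilon> \<Longrightarrow>
      \<exists>y. (\<forall>n\<in>I. y n \<in> Y n) \<and> (\<forall>j\<in>J. (\<Sum>n\<in>I. y n j) \<le> \<gamma> j + \<epsilon>)"
  shows "\<exists>y. (\<forall>n\<in>I. y n \<in> Y n) \<and> (\<forall>j\<in>J. (\<Sum>n\<in>I. y n j) \<le> \<gamma> j)"
proof -
  define Z where "Z n = (if n \<in> I then Y n else {\<lambda>_. 0})" for n
  define K where "K = (\<Pi>\<^sub>E n\<in>UNIV. Z n)"
  have "compactin (product_topology (\<lambda>_. euclidean) UNIV) K"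
    unfolding K_def compactin_PiE using Y by (auto simp: Z_def)
  then have K: "compact K" by (simp add: euclidean_product_topology)
  have K_iff: "y \<in> K \<longleftrightarrow> (\<forall>n. y n \<in> Z n)" for y by (auto simp: K_def)
  have to_K: "(\<lambda>n. if n \<in> I then y n else (\<lambda>_. 0)) \<in> K" if "\<forall>n\<in>I. y n \<in> Y n" for y
    using that by (auto simp: K_iff Z_def)
  define \<psi> where "\<psi> y = (\<Sum>j\<in>J. max 0 ((\<Sum>n\<in>I. y n j) - \<gamma> j))" for y :: "'n \<Rightarrow> 'j \<Rightarrow> real"
  have "continuous_on K (\<lambda>y. y n j)" for n j
    by (rule continuous_on_product_then_coordinatewise[OF
          continuous_on_product_then_coordinatewise[OF continuous_on_id]])
  then have cont: "continuous_on K \<psi>"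
    unfolding \<psi>_def by (intro continuous_intros) auto
  have "K \<noteq> {}" using to_K approx[of 1] by fastforce
  then obtain y where y: "y \<in> K" "\<And>z. z \<in> K \<Longrightarrow> \<psi> y \<le> \<psi> z"
    using continuous_attains_inf[OF K _ cont] by blast
  have "\<psi> y \<le> 0 + e" if e: "0 < e" for e
  proof -
    define \<epsilon> where "\<epsilon> = e / (card J + 1)"
    have \<epsilon>: "0 < \<epsilon>" using e by (simp add: \<epsilon>_def)
    then obtain z where z: "\<forall>n\<in>I. z n \<in> Y n" "\<forall>j\<in>J. (\<Sum>n\<in>I. z n j) \<le> \<gamma> j + \<epsilon>"
      using approx by blast
    have "\<psi> y \<le> (\<Sum>j\<in>J. max 0 ((\<Sum>n\<in>I. z n j) - \<gamma> j))"
      using y(2)[OF to_K[OF z(1)]] by (simp add: \<psi>_def cong: sum.cong)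
    also have "\<dots> \<le> (\<Sum>j\<in>J. \<epsilon>)"
      using z(2) \<epsilon> by (intro sum_mono) (auto simp: algebra_simps)
    also have "\<dots> \<le> e" using e by (simp add: \<epsilon>_def field_simps)
    finally show ?thesis by simp
  qed
  then have "\<psi> y \<le> 0" by (rule field_le_epsilon)
  moreover have "0 \<le> \<psi> y" unfolding \<psi>_def by (intro sum_nonneg) simp
  ultimately have "\<psi> y = 0" by simp
  then have "\<forall>j\<in>J. max 0 ((\<Sum>n\<in>I. y n j) - \<gamma> j) = 0"
    unfolding \<psi>_def using J by (subst (asm) sum_nonneg_eq_0_iff) auto
  then have "\<forall>j\<in>J. (\<Sum>n\<in>I. y n j) \<le> \<gamma> j" by (auto simp: max_def split: if_splits)
  moreover have "\<forall>n\<in>I. y n \<in> Y n" using y(1) by (auto simp: K_iff Z_def split: if_splits)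
  ultimately show ?thesis by blast
qed

text \<open>
  The nonconvex duality principle. If no Lagrange multiplier refutes the inequalities with right-hand
  side \<open>\<beta>\<close>, then they have an approximate solution in convex combinations. At most \<open>card J\<close> summands of
  it are proper combinations, and rounding each of them costs at most \<open>\<rho>\<close>.
\<close>

lemma shapley_folkman_rounding:
  fixes Y :: "'n \<Rightarrow> ('j \<Rightarrow> real) set"
  assumes I: "finite I" and J: "finite J"
    and Y: "\<And>n. n \<in> I \<Longrightarrow> compact (Y n)" "\<And>n. n \<in> I \<Longrightarrow> Y n \<noteq> {}"
    and \<rho>: "\<And>j. j \<in> J \<Longrightarrow> 0 \<le> \<rho> j"
    and rounding: "\<And>n (m::nat) q d. n \<in> I \<Longrightarrow> (\<And>k. k < m \<Longrightarrow> 0 \<le> q k \<and> d k \<in> Y n) \<Longrightarrow>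
      (\<Sum>k<m. q k) = 1 \<Longrightarrow> \<exists>y\<in>Y n. \<forall>j\<in>J. y j \<le> (\<Sum>k<m. q k * d k j) + \<rho> j"
    and nosep: "\<And>\<mu>. (\<And>j. 0 \<le> \<mu> j) \<Longrightarrow>
      \<exists>y. (\<forall>n\<in>I. y n \<in> Y n) \<and> (\<Sum>j\<in>J. \<mu> j * (\<Sum>n\<in>I. y n j)) \<le> (\<Sum>j\<in>J. \<mu> j * \<beta> j)"
  shows "\<exists>y. (\<forall>n\<in>I. y n \<in> Y n) \<and> (\<forall>j\<in>J. (\<Sum>n\<in>I. y n j) \<le> \<beta> j + real (card J) * \<rho> j)"
proof (rule compact_sums_limit[OF I J Y(1)])
  fix \<epsilon> :: real assume \<epsilon>: "0 < \<epsilon>"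
  define D where "D = {y. \<forall>n\<in>I. y n \<in> Y n}"
  have "\<exists>B. \<forall>z\<in>Y n. \<bar>z j\<bar> \<le> B" if "n \<in> I" for n j
  proof -
    have "continuous_on (Y n) (\<lambda>z. z j)"
      by (rule continuous_on_product_then_coordinatewise[OF continuous_on_id])
    then have "compact ((\<lambda>z. z j) ` Y n)" using Y(1)[OF that] by (rule compact_continuous_image)
    then have "bounded ((\<lambda>z. z j) ` Y n)" by (rule compact_imp_bounded)
    then show ?thesis by (auto simp: bounded_iff)
  qed
  then obtain B where B: "\<And>n j z. n \<in> I \<Longrightarrow> z \<in> Y n \<Longrightarrow> \<bar>z j\<bar> \<le> B n j" by metis
  define b where "b j = (\<Sum>n\<in>I. B n j) + \<bar>\<beta> j\<bar>" for j
  have b: "\<bar>(\<Sum>n\<in>I. y n j) - \<beta> j\<bar> \<le> b j" if "y \<in> D" for y j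
  proof -
    have "\<bar>\<Sum>n\<in>I. y n j\<bar> \<le> (\<Sum>n\<in>I. B n j)"
      using B that by (intro order_trans[OF sum_abs] sum_mono) (auto simp: D_def)
    then show ?thesis unfolding b_def by linarith
  qed
  have D_ne: "D \<noteq> {}"
  proof -
    have "(\<lambda>n. SOME z. z \<in> Y n) \<in> D" using Y(2) by (auto simp: D_def some_in_eq)
    then show ?thesis by blast
  qed
  have b_nonneg: "0 \<le> b j" for j using b[of _ j] D_ne by fastforce
  have M: "\<bar>(\<Sum>n\<in>I. y n j) - \<beta> j\<bar> \<le> (\<Sum>j\<in>J. b j)" if "y \<in> D" "j \<in> J" for y j
  proof -
    have "b j \<le> (\<Sum>j\<in>J. b j)" using that(2) J b_nonneg by (intro member_le_sum) auto
    then show ?thesis using b[OF that(1), of j] by linarith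
  qed
  have "\<exists>F q. finite F \<and> F \<subseteq> D \<and> (\<forall>d\<in>F. 0 \<le> q d) \<and> (\<Sum>d\<in>F. q d) = 1 \<and>
           (\<forall>j\<in>J. (\<Sum>d\<in>F. q d * ((\<Sum>n\<in>I. d n j) - \<beta> j)) \<le> \<epsilon>)"
  proof (rule gordan_alternative[OF J D_ne M _ \<epsilon>])
    fix \<mu> :: "'j \<Rightarrow> real" assume "\<And>j. 0 \<le> \<mu> j"
    then show "\<exists>d\<in>D. (\<Sum>j\<in>J. \<mu> j * ((\<Sum>n\<in>I. d n j) - \<beta> j)) \<le> 0"
      using nosep[of \<mu>] by (auto simp: D_def right_diff_distrib sum_subtractf)
  qed
  then obtain F q where F: "finite F" "F \<subseteq> D" "\<forall>d\<in>F. 0 \<le> q d" "(\<Sum>d\<in>F. q d) = 1"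
      and F_le: "\<And>j. j \<in> J \<Longrightarrow> (\<Sum>d\<in>F. q d * ((\<Sum>n\<in>I. d n j) - \<beta> j)) \<le> \<epsilon>"
    by blast
  obtain S p where SF: "\<forall>n\<in>I. S n \<subseteq> F \<and> (\<forall>d\<in>S n. 0 < p n d) \<and> (\<Sum>d\<in>S n. p n d) = (1::real)"
      and mixed: "card {n\<in>I. \<not> is_singleton (S n)} \<le> card J"
      and S_sum: "\<forall>j\<in>J. (\<Sum>n\<in>I. \<Sum>d\<in>S n. p n d * d n j) = (\<Sum>d\<in>F. q d * (\<Sum>n\<in>I. d n j))"
    using shapley_folkman[OF I J F(1,3,4), of "\<lambda>n d. d n"] by (elim exE conjE)
  have S: "S n \<subseteq> F" "\<And>d. d \<in> S n \<Longrightarrow> 0 < p n d" "(\<Sum>d\<in>S n. p n d) = 1" if "n \<in> I" for n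
    using SF that by blast+
  define good where "good n y \<longleftrightarrow> y \<in> Y n \<and>
    (\<forall>j\<in>J. y j \<le> (\<Sum>d\<in>S n. p n d * d n j) + of_bool (\<not> is_singleton (S n)) * \<rho> j)" for n y
  have "\<exists>y. good n y" if n: "n \<in> I" for n
  proof (cases "is_singleton (S n)")
    case True
    then obtain d where d: "S n = {d}" by (auto simp: is_singleton_def)
    moreover have "p n d = 1" using S(3)[OF n] d by simp
    moreover have "d n \<in> Y n" using S(1)[OF n] F(2) d n by (auto simp: D_def)
    ultimately show ?thesis by (intro exI[of _ "d n"]) (auto simp: good_def)
  next
    case False
    have "finite (S n)" using S(1)[OF n] F(1) by (rule finite_subset)
    then obtain e where "bij_betw e {0..<card (S n)} (S n)" using ex_bij_betw_nat_finite by blast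
    then have e: "bij_betw e {..<card (S n)} (S n)" by (simp add: lessThan_atLeast0)
    have sum_e: "(\<Sum>k<card (S n). g (e k)) = (\<Sum>d\<in>S n. g d)" for g :: "_ \<Rightarrow> real"
      by (rule sum.reindex_bij_betw[OF e])
    have "\<exists>y\<in>Y n. \<forall>j\<in>J. y j \<le> (\<Sum>k<card (S n). p n (e k) * e k n j) + \<rho> j"
    proof (rule rounding[OF n, where q = "\<lambda>k. p n (e k)" and d = "\<lambda>k. e k n"])
      fix k assume "k < card (S n)"
      then have "e k \<in> S n" using bij_betwE[OF e] by auto
      then have "0 < p n (e k)" "e k \<in> D" using S(1,2)[OF n] F(2) by blast+
      then show "0 \<le> p n (e k) \<and> e k n \<in> Y n" using n by (simp add: D_def)
    next
      show "(\<Sum>k<card (S n). p n (e k)) = 1" using sum_e[of "p n"] S(3)[OF n] by simp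
    qed
    moreover have "(\<Sum>k<card (S n). p n (e k) * e k n j) = (\<Sum>d\<in>S n. p n d * d n j)" for j
      by (rule sum_e)
    ultimately show ?thesis using False by (auto simp: good_def)
  qed
  then obtain y where good: "\<And>n. n \<in> I \<Longrightarrow> good n (y n)" by metis
  have y: "y n \<in> Y n"
      "\<And>j. j \<in> J \<Longrightarrow> y n j \<le> (\<Sum>d\<in>S n. p n d * d n j) + of_bool (\<not> is_singleton (S n)) * \<rho> j"
    if "n \<in> I" for n
    using good[OF that] by (simp_all add: good_def)
  have "(\<Sum>n\<in>I. y n j) \<le> (\<beta> j + real (card J) * \<rho> j) + \<epsilon>" if j: "j \<in> J" for j
  proof -
    have "(\<Sum>n\<in>I. y n j)
        \<le> (\<Sum>n\<in>I. (\<Sum>d\<in>S n. p n d * d n j) + of_bool (\<not> is_singleton (S n)) * \<rho> j)"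
      using y(2) j by (intro sum_mono) auto
    also have "\<dots> = (\<Sum>d\<in>F. q d * (\<Sum>n\<in>I. d n j)) + card {n\<in>I. \<not> is_singleton (S n)} * \<rho> j"
    proof -
      have "(\<Sum>n\<in>I. of_bool (\<not> is_singleton (S n)) * \<rho> j)
          = real (card {n\<in>I. \<not> is_singleton (S n)}) * \<rho> j"
        unfolding sum_distrib_right[symmetric] of_bool_def sum.inter_filter[OF I, symmetric] by simp
      then show ?thesis using S_sum j by (simp only: sum.distrib)
    qed
    also have "(\<Sum>d\<in>F. q d * (\<Sum>n\<in>I. d n j)) = (\<Sum>d\<in>F. q d * ((\<Sum>n\<in>I. d n j) - \<beta> j)) + \<beta> j"
      using F(4) by (simp add: right_diff_distrib sum_subtractf flip: sum_distrib_right)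
    also have "card {n\<in>I. \<not> is_singleton (S n)} * \<rho> j \<le> card J * \<rho> j"
      using mixed \<rho>[OF j] by (intro mult_right_mono) auto
    finally show ?thesis using F_le[OF j] by linarith
  qed
  then show "\<exists>y. (\<forall>n\<in>I. y n \<in> Y n) \<and> (\<forall>j\<in>J. (\<Sum>n\<in>I. y n j) \<le> (\<beta> j + real (card J) * \<rho> j) + \<epsilon>)"
    using y(1) by blast
qed

section \<open>Stage gains of one project\<close>

lemma trans_law_prob:
  assumes "is_project p" "(x, a) \<in> feas p"
  shows "prob_space (trans_law p x a)" "sets (trans_law p x a) = sets (states p)"
proof -
  have "(\<lambda>(x, a). trans_law p x a)
      \<in> restrict_space (states p \<Otimes>\<^sub>M borel) (feas p) \<rightarrow>\<^sub>M prob_algebra (states p)"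
    using assms(1) by (simp add: is_project_def)
  moreover have "(x, a) \<in> space (restrict_space (states p \<Otimes>\<^sub>M borel) (feas p))"
    using assms(2) by (auto simp: space_restrict_space space_pair_measure feas_def)
  ultimately have "trans_law p x a \<in> space (prob_algebra (states p))"
    by (auto dest: measurable_space)
  then show "prob_space (trans_law p x a)" "sets (trans_law p x a) = sets (states p)"
    by (auto simp: space_prob_algebra)
qed

lemma trans_law_integrable:
  assumes "is_project p" "(x, a) \<in> feas p" "bounded_measurable (states p) h"
  shows "integrable (trans_law p x a) h"
proof -
  interpret prob_space "trans_law p x a" by (rule trans_law_prob[OF assms(1,2)])
  note sets = trans_law_prob(2)[OF assms(1,2)]
  obtain M where "\<And>y. y \<in> space (states p) \<Longrightarrow> norm (h y) \<le> M"
    using assms(3) by (auto simp: bounded_measurable_def bounded_iff)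
  then show ?thesis
    using assms(3) sets
    by (intro integrable_const_bound[of _ M])
       (auto simp: bounded_measurable_def sets_eq_imp_space_eq[OF sets] cong: measurable_cong_sets)
qed

lemma abs_trans_law_integral_le:
  assumes "is_project p" "(x, a) \<in> feas p" "bounded_measurable (states p) h"
    and M: "\<And>y. y \<in> space (states p) \<Longrightarrow> \<bar>h y\<bar> \<le> M"
  shows "\<bar>\<integral>y. h y \<partial>trans_law p x a\<bar> \<le> M"
proof -
  interpret prob_space "trans_law p x a" by (rule trans_law_prob[OF assms(1,2)])
  have space: "space (trans_law p x a) = space (states p)"
    by (rule sets_eq_imp_space_eq[OF trans_law_prob(2)[OF assms(1,2)]])
  have "(\<integral>y. h y \<partial>trans_law p x a) \<le> M" "- M \<le> (\<integral>y. h y \<partial>trans_law p x a)"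
    using M by (intro integral_le_const integral_ge_const trans_law_integrable[OF assms(1-3)] AE_I2;
                force simp: space abs_le_iff)+
  then show ?thesis by linarith
qed

lemma abs_stage_gain_bounded:
  assumes "is_project p" "bounded_measurable (states p) h"
  obtains M where "\<And>x a. (x, a) \<in> feas p \<Longrightarrow> \<bar>stage_gain \<beta> p h x a\<bar> \<le> M"
proof -
  obtain A where A: "\<And>x a. (x, a) \<in> feas p \<Longrightarrow> \<bar>rew p x a\<bar> \<le> A"
    using assms(1) by (force simp: is_project_def bounded_iff)
  obtain B where B: "\<And>y. y \<in> space (states p) \<Longrightarrow> \<bar>h y\<bar> \<le> B"
    using assms(2) by (auto simp: bounded_measurable_def bounded_iff)
  show thesis
  proof
    fix x a assume xa: "(x, a) \<in> feas p"
    have "\<bar>\<beta> * (\<integral>y. h y \<partial>trans_law p x a)\<bar> \<le> \<bar>\<beta>\<bar> * B"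
      using abs_trans_law_integral_le[OF assms(1) xa assms(2) B]
      by (simp add: abs_mult mult_left_mono)
    then show "\<bar>stage_gain \<beta> p h x a\<bar> \<le> A + \<bar>\<beta>\<bar> * B + B"
      using A[OF xa] B[of x] xa unfolding stage_gain_def feas_def by auto
  qed
qed

lemma stage_gain_diff_le_Gam:
  assumes "is_project p" "bounded_measurable (states p) h"
    and "(x, a) \<in> feas p" "(x', a') \<in> feas p"
  shows "stage_gain \<beta> p h x a - stage_gain \<beta> p h x' a' \<le> Gam \<beta> p h"
proof -
  let ?g = "\<lambda>(x, a). stage_gain \<beta> p h x a"
  obtain M where M: "\<And>x a. (x, a) \<in> feas p \<Longrightarrow> \<bar>stage_gain \<beta> p h x a\<bar> \<le> M"
    using abs_stage_gain_bounded[OF assms(1,2)] by blast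
  have "bdd_above (?g ` feas p)" "bdd_below (?g ` feas p)"
    using M by (auto intro!: bdd_aboveI2[of _ _ M] bdd_belowI2[of _ "- M"] simp: abs_le_iff minus_le_iff)
  then have "?g (x, a) \<le> (SUP z\<in>feas p. ?g z)" "(INF z\<in>feas p. ?g z) \<le> ?g (x', a')"
    using assms(3,4) by (blast intro: cSUP_upper cINF_lower)+
  then show ?thesis unfolding Gam_def by simp
qed

lemma Gam_le:
  assumes "feas p \<noteq> {}" "\<And>x a. (x, a) \<in> feas p \<Longrightarrow> \<bar>stage_gain \<beta> p h x a\<bar> \<le> M"
  shows "Gam \<beta> p h \<le> 2 * M"
proof -
  have "(SUP (x, a)\<in>feas p. stage_gain \<beta> p h x a) \<le> M"
    using assms by (intro cSUP_least) (auto simp: abs_le_iff)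
  moreover have "- M \<le> (INF (x, a)\<in>feas p. stage_gain \<beta> p h x a)"
    using assms by (intro cINF_greatest) (auto simp: abs_le_iff minus_le_iff)
  ultimately show ?thesis unfolding Gam_def by linarith
qed

text \<open>
  With \<open>M = sup \<bar>h\<bar>\<close>, the Bellman equation gives \<open>M \<le> C + \<beta> * M\<close>.
\<close>

lemma abs_bellman_solution_le:
  assumes \<beta>: "0 < \<beta>" "\<beta> < 1" and p: "is_project p" and h: "bellman_solution \<beta> lam p h"
    and C: "\<And>x a. (x, a) \<in> feas p \<Longrightarrow> \<bar>rew p x a - lam \<bullet> constr p x a\<bar> \<le> C"
    and x: "x \<in> space (states p)"
  shows "\<bar>h x\<bar> \<le> C / (1 - \<beta>)"
proof -
  have h_meas: "bounded_measurable (states p) h" using h by (simp add: bellman_solution_def)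
  define M where "M = (SUP y\<in>space (states p). \<bar>h y\<bar>)"
  obtain B where "\<And>y. y \<in> space (states p) \<Longrightarrow> \<bar>h y\<bar> \<le> B"
    using h_meas by (auto simp: bounded_measurable_def bounded_iff)
  then have M: "\<bar>h y\<bar> \<le> M" if "y \<in> space (states p)" for y
    unfolding M_def using that by (intro cSUP_upper) (auto intro!: bdd_aboveI2)
  have "\<bar>h y\<bar> \<le> C + \<beta> * M" if y: "y \<in> space (states p)" for y
  proof -
    let ?g = "\<lambda>a. rew p y a - lam \<bullet> constr p y a + \<beta> * (\<integral>z. h z \<partial>trans_law p y a)"
    have "\<bar>?g a\<bar> \<le> C + \<beta> * M" if a: "a \<in> acts p y" for a
    proof -
      have ya: "(y, a) \<in> feas p" using y a by (simp add: feas_def)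
      have "\<bar>\<beta> * (\<integral>z. h z \<partial>trans_law p y a)\<bar> \<le> \<beta> * M"
        using abs_trans_law_integral_le[OF p ya h_meas M] \<beta> by (simp add: abs_mult)
      then show ?thesis using C[OF ya] by linarith
    qed
    moreover have "acts p y \<noteq> {}" "h y = (SUP a\<in>acts p y. ?g a)"
      using h y by (auto simp: bellman_solution_def)
    ultimately show ?thesis by (simp only:, intro cSup_abs_le) auto
  qed
  then have "M \<le> C + \<beta> * M" unfolding M_def[symmetric]
    by (subst M_def, intro cSUP_least) (use x in auto)
  then have "M \<le> C / (1 - \<beta>)" using \<beta> by (simp add: field_simps)
  then show ?thesis using M[OF x] by linarith
qed

lemma Gam_bellman_solution_le:
  assumes \<beta>: "0 < \<beta>" "\<beta> < 1" and p: "is_project p" and h: "bellman_solution \<beta> lam p h"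
    and C: "\<And>x a. (x, a) \<in> feas p \<Longrightarrow> \<bar>rew p x a\<bar> \<le> C"
      "\<And>x a. (x, a) \<in> feas p \<Longrightarrow> \<bar>rew p x a - lam \<bullet> constr p x a\<bar> \<le> C"
  shows "Gam \<beta> p h \<le> 4 * C / (1 - \<beta>)"
proof -
  define D where "D = C / (1 - \<beta>)"
  note h_le = abs_bellman_solution_le[OF \<beta> p h C(2), folded D_def]
  have h_meas: "bounded_measurable (states p) h" using h by (simp add: bellman_solution_def)
  have "Gam \<beta> p h \<le> 2 * (2 * D)"
  proof (rule Gam_le)
    obtain x where x: "x \<in> space (states p)" using p by (auto simp: is_project_def)
    moreover from x obtain a where "a \<in> acts p x" using h by (auto simp: bellman_solution_def)
    ultimately show "feas p \<noteq> {}" by (auto simp: feas_def)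
  next
    fix x a assume xa: "(x, a) \<in> feas p"
    then have "\<bar>h x\<bar> \<le> D" using h_le by (simp add: feas_def)
    moreover have "\<bar>\<beta> * (\<integral>y. h y \<partial>trans_law p x a)\<bar> \<le> \<beta> * D"
      using abs_trans_law_integral_le[OF p xa h_meas h_le] \<beta> by (simp add: abs_mult)
    moreover have "C + \<beta> * D = D" using \<beta> by (simp add: D_def field_simps)
    ultimately show "\<bar>stage_gain \<beta> p h x a\<bar> \<le> 2 * D"
      using C(1)[OF xa] unfolding stage_gain_def by linarith
  qed
  then show ?thesis by (simp add: D_def)
qed

section \<open>Joint paths of a fixed scenario\<close>

text \<open>
  The marginals of the product law are the laws of the projects.
\<close>

lemma integral_separable:
  assumes W: "is_wcdp W"
    and h: "\<And>n. n \<in> {1..nproj W} \<Longrightarrow> bounded_measurable (states (proj W n)) (h n)"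
    and xa: "\<And>n. n \<in> {1..nproj W} \<Longrightarrow> (x n, a n) \<in> feas (proj W n)"
  shows "(\<integral>y. separable W \<theta> h y \<partial>joint_trans W x a)
       = \<theta> + (\<Sum>n=1..nproj W. \<integral>y. h n y \<partial>trans_law (proj W n) (x n) (a n))"
proof -
  let ?I = "{1..nproj W}" and ?M = "\<lambda>n. trans_law (proj W n) (x n) (a n)"
  have p: "is_project (proj W n)" if "n \<in> ?I" for n using W that by (auto simp: is_wcdp_def)
  have prob: "prob_space (?M n)" if "n \<in> ?I" for n
    using trans_law_prob(1)[OF p xa] that by blast
  have int: "integrable (?M n) (h n)" if "n \<in> ?I" for n
    using trans_law_integrable[OF p xa h] that by blast
  interpret J: prob_space "joint_trans W x a"
    unfolding joint_trans_def by (intro prob_space_PiM prob)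
  have distr: "distr (joint_trans W x a) (?M n) (\<lambda>y. y n) = ?M n" if "n \<in> ?I" for n
    unfolding joint_trans_def using that prob by (intro distr_PiM_component) auto
  have meas: "(\<lambda>y. y n) \<in> joint_trans W x a \<rightarrow>\<^sub>M ?M n" if "n \<in> ?I" for n
    unfolding joint_trans_def using that by measurable
  have int': "integrable (joint_trans W x a) (\<lambda>y. h n (y n))" if "n \<in> ?I" for n
    using integrable_distr[OF meas[OF that], of "h n"] int[OF that] unfolding distr[OF that] by simp
  have eq: "(\<integral>y. h n (y n) \<partial>joint_trans W x a) = (\<integral>y. h n y \<partial>?M n)" if "n \<in> ?I" for n
    using integral_distr[OF meas[OF that], of "h n"] int[OF that] unfolding distr[OF that] by simp
  have "(\<integral>y. separable W \<theta> h y \<partial>joint_trans W x a)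
      = (\<integral>y. \<theta> \<partial>joint_trans W x a) + (\<integral>y. (\<Sum>n\<in>?I. h n (y n)) \<partial>joint_trans W x a)"
    unfolding separable_def using int' by (intro Bochner_Integration.integral_add) auto
  also have "(\<integral>y. (\<Sum>n\<in>?I. h n (y n)) \<partial>joint_trans W x a) = (\<Sum>n\<in>?I. \<integral>y. h n y \<partial>?M n)"
    using int' by (subst Bochner_Integration.integral_sum) (auto simp: eq)
  finally show ?thesis by (simp add: J.prob_space)
qed

lemma state_at_cong:
  "(\<And>s. s < t \<Longrightarrow> a s = a' s) \<Longrightarrow> state_at S n a \<omega> t = state_at S n a' \<omega> t"
  unfolding state_at_def by (intro arg_cong[where f = "\<lambda>l. state_of S n l \<omega>"] map_cong) auto

locale fixed_scenario =
  fixes \<beta> :: real and W :: "('s, 'l::finite) wcdp" and S :: "('s, 'w) scenarios"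
    and \<theta> :: real and h :: "nat \<Rightarrow> 's \<Rightarrow> real" and \<omega> :: 'w and T :: nat
  assumes W: "is_wcdp W" and S: "is_scenarios W S" and \<omega>: "\<omega> \<in> space (scen S)"
    and h: "\<And>n. n \<in> {1..nproj W} \<Longrightarrow> bounded_measurable (states (proj W n)) (h n)"
    and assumption1: "assumption1 W"
    and assumption2: "assumption2 \<beta> W S h \<omega> T"
    and assumption3: "assumption3 W S \<omega> T"
begin

abbreviation projects where "projects \<equiv> {1..nproj W}"
abbreviation paths where "paths n \<equiv> proj_paths W S n \<omega> T"
abbreviation profiles where "profiles \<equiv> {y. \<forall>n\<in>projects. y n \<in> paths n}"

definition join :: "(nat \<Rightarrow> nat \<Rightarrow> action) \<Rightarrow> nat \<Rightarrow> nat \<Rightarrow> action" where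
  "join y = (\<lambda>t\<in>{..T}. \<lambda>n\<in>projects. y n t)"

text \<open>
  The coordinates of one project in the sum that is optimised: the negative payoff at \<open>None\<close>, so that
  smaller is better in every coordinate, and the use of constraint \<open>l\<close> at time \<open>t\<close> at \<open>Some (t, l)\<close>.
  Coordinates beyond the horizon get the default \<open>0\<close> and are left out of \<open>coords\<close>.
\<close>

definition outcome :: "nat \<Rightarrow> (nat \<Rightarrow> action) \<Rightarrow> (nat \<times> 'l) option \<Rightarrow> real" where
  "outcome n a j = (case j of None \<Rightarrow> - proj_payoff \<beta> W S n (h n) a \<omega> T
     | Some (t, l) \<Rightarrow> if t \<le> T then proj_constr W S n t a \<omega> $ l else 0)"

definition coords :: "(nat \<times> 'l) option set" where
  "coords = insert None (Some ` ({..T} \<times> UNIV))"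

lemma finite_coords: "finite coords" by (simp add: coords_def)

lemma card_coords: "card coords = (T + 1) * CARD('l) + 1"
  by (simp add: coords_def card_image card_cartesian_product)

lemma sum_coords: "(\<Sum>j\<in>coords. g j) = g None + (\<Sum>t\<le>T. \<Sum>l\<in>UNIV. g (Some (t, l)))"
proof -
  have "(\<Sum>j\<in>coords. g j) = g None + (\<Sum>j\<in>Some ` ({..T} \<times> UNIV). g j)"
    unfolding coords_def by (subst sum.insert) auto
  also have "(\<Sum>j\<in>Some ` ({..T} \<times> UNIV). g j) = (\<Sum>z\<in>{..T} \<times> UNIV. g (Some z))"
    by (subst sum.reindex) auto
  also have "\<dots> = (\<Sum>t\<le>T. \<Sum>l\<in>UNIV. g (Some (t, l)))"
    by (subst sum.cartesian_product) (auto intro: sum.cong)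
  finally show ?thesis .
qed

lemma is_project: "n \<in> projects \<Longrightarrow> is_project (proj W n)"
  using W by (auto simp: is_wcdp_def)

lemma state_in_space:
  assumes "n \<in> projects" "\<And>s. s < t \<Longrightarrow> a s \<in> acts (proj W n) (state_at S n a \<omega> s)"
  shows "state_at S n a \<omega> t \<in> space (states (proj W n))"
proof -
  have "\<forall>n\<in>projects. \<forall>\<omega>\<in>space (scen S). \<forall>a t.
        (\<forall>s<t. a s \<in> acts (proj W n) (state_at S n a \<omega> s)) \<longrightarrow>
        state_at S n a \<omega> t \<in> space (states (proj W n))"
    using S unfolding is_scenarios_def by (elim conjE)
  then show ?thesis using assms \<omega> by blast
qed

lemma path_feas:
  assumes "n \<in> projects" "a \<in> paths n" "t \<le> T"
  shows "(state_at S n a \<omega> t, a t) \<in> feas (proj W n)"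
  using assms state_in_space[OF assms(1), of t a] by (simp add: feas_def proj_paths_def)

lemma join_at: "t \<le> T \<Longrightarrow> n \<in> projects \<Longrightarrow> join y t n = y n t"
  by (simp add: join_def)

lemma joint_state_at_join:
  assumes "t \<le> T" "n \<in> projects"
  shows "joint_state_at W S (join y) \<omega> t n = state_at S n (y n) \<omega> t"
proof -
  have "state_at S n (\<lambda>s. join y s n) \<omega> t = state_at S n (y n) \<omega> t"
    using assms by (intro state_at_cong) (simp add: join_def)
  then show ?thesis using assms by (simp add: joint_state_at_def)
qed

text \<open>
  The projects are coupled by the constraints only, so joint paths are arbitrary families of project
  paths. Thus all optimisations below run over \<open>profiles\<close>.
\<close>

lemma joint_paths_eq: "joint_paths W S \<omega> T = join ` profiles"
proof (intro equalityI subsetI)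
  fix a assume a: "a \<in> joint_paths W S \<omega> T"
  define y where "y n = (\<lambda>t\<in>{..T}. a t n)" for n
  have join_y: "join y = a"
  proof
    fix t
    show "join y t = a t"
    proof (cases "t \<le> T")
      case True
      then have "a t \<in> extensional projects"
        using a by (auto simp: joint_paths_def joint_acts_def PiE_def)
      then have "restrict (a t) projects = a t" by (rule extensional_restrict)
      moreover have "join y t = restrict (a t) projects"
        using True by (simp add: join_def y_def cong: restrict_cong)
      ultimately show ?thesis by simp
    next
      case False
      then show ?thesis using a by (simp add: join_def joint_paths_def extensional_def)
    qed
  qed
  have "y n \<in> paths n" if n: "n \<in> projects" for n
  proof -
    have "y n t \<in> acts (proj W n) (state_at S n (y n) \<omega> t)" if t: "t \<le> T" for t
    proof -
      have "a t n \<in> acts (proj W n) (joint_state_at W S a \<omega> t n)"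
        using a t n unfolding joint_paths_def joint_acts_def by (blast dest: PiE_mem)
      then show ?thesis using joint_state_at_join[OF t n, of y] t by (simp add: join_y y_def)
    qed
    then show ?thesis by (simp add: proj_paths_def y_def)
  qed
  then show "a \<in> join ` profiles" using join_y by blast
next
  fix a assume "a \<in> join ` profiles"
  then obtain y where y: "y \<in> profiles" "a = join y" by blast
  have "join y t \<in> joint_acts W (joint_state_at W S (join y) \<omega> t)" if t: "t \<le> T" for t
    unfolding joint_acts_def
  proof (rule PiE_I)
    fix n assume n: "n \<in> projects"
    then have "y n t \<in> acts (proj W n) (state_at S n (y n) \<omega> t)"
      using y(1) t by (simp add: proj_paths_def)
    then show "join y t n \<in> acts (proj W n) (joint_state_at W S (join y) \<omega> t n)"
      using joint_state_at_join[OF t n] t n by (simp add: join_def)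
  qed (use t in \<open>auto simp: join_def\<close>)
  then show "a \<in> joint_paths W S \<omega> T"
    by (simp add: y(2) joint_paths_def) (simp add: join_def)
qed

lemma joint_constr_join:
  assumes "t \<le> T"
  shows "joint_constr W (joint_state_at W S (join y) \<omega> t) (join y t)
       = (\<Sum>n\<in>projects. proj_constr W S n t (y n) \<omega>)"
  unfolding joint_constr_def proj_constr_def
  by (intro sum.cong refl) (use assms in \<open>simp add: joint_state_at_join join_at\<close>)

lemma joint_paths_bar_eq:
  "joint_paths_bar W S \<omega> T =
     join ` {y\<in>profiles. \<forall>t\<le>T. (\<Sum>n\<in>projects. proj_constr W S n t (y n) \<omega>) \<le> bvec W}"
proof -
  have "joint_paths_bar W S \<omega> T = {a\<in>joint_paths W S \<omega> T.
      \<forall>t\<le>T. joint_constr W (joint_state_at W S a \<omega> t) (a t) \<le> bvec W}"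
    by (auto simp: joint_paths_bar_def joint_paths_def joint_acts_bar_def)
  then show ?thesis by (auto simp: joint_paths_eq joint_constr_join)
qed

text \<open>
  Assumption 1 allows a feasible action in whatever joint state has been reached, so a feasible path
  can be built forward in time; a later action does not change earlier states.
\<close>

lemma joint_paths_bar_nonempty: "joint_paths_bar W S \<omega> T \<noteq> {}"
proof -
  have "\<exists>a. \<forall>t<k. a t \<in> joint_acts_bar W (joint_state_at W S a \<omega> t)" for k
  proof (induction k)
    case (Suc k)
    then obtain a where a: "\<forall>t<k. a t \<in> joint_acts_bar W (joint_state_at W S a \<omega> t)" by blast
    have "state_at S n (\<lambda>s. a s n) \<omega> k \<in> space (states (proj W n))" if n: "n \<in> projects" for n
      using a n by (intro state_in_space) (auto simp: joint_acts_bar_def joint_acts_def joint_state_at_def PiE_iff)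
    then have "joint_state_at W S a \<omega> k \<in> space (joint_states W)"
      by (auto simp: joint_states_def joint_state_at_def space_PiM)
    then obtain b where b: "b \<in> joint_acts_bar W (joint_state_at W S a \<omega> k)"
      using assumption1 by (auto simp: assumption1_def)
    define a' where "a' = a(k := b)"
    have "joint_state_at W S a' \<omega> t = joint_state_at W S a \<omega> t" if "t \<le> k" for t
      unfolding joint_state_at_def using that by (intro restrict_ext state_at_cong) (auto simp: a'_def)
    moreover have "a' k = b" "\<And>t. t < k \<Longrightarrow> a' t = a t" by (simp_all add: a'_def)
    ultimately have "\<forall>t<Suc k. a' t \<in> joint_acts_bar W (joint_state_at W S a' \<omega> t)"
      using a b by (simp add: less_Suc_eq)
    then show ?case by blast
  qed simp
  then obtain a where a: "\<forall>t<Suc T. a t \<in> joint_acts_bar W (joint_state_at W S a \<omega> t)" by blast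
  have "joint_state_at W S (restrict a {..T}) \<omega> t = joint_state_at W S a \<omega> t" if "t \<le> T" for t
    unfolding joint_state_at_def using that by (intro restrict_ext state_at_cong) auto
  then have "restrict a {..T} \<in> joint_paths_bar W S \<omega> T"
    using a by (simp add: joint_paths_bar_def less_Suc_eq_le)
  then show ?thesis by blast
qed

lemma feasible_profile:
  obtains y where "y \<in> profiles"
    "\<And>t. t \<le> T \<Longrightarrow> (\<Sum>n\<in>projects. proj_constr W S n t (y n) \<omega>) \<le> bvec W"
  using joint_paths_bar_nonempty unfolding joint_paths_bar_eq by blast

text \<open>
  The payoff is additively separable across projects. The constant \<open>\<theta>\<close> enters every stage through
  \<open>\<beta> * \<theta> - \<theta>\<close>.
\<close>

lemma info_payoff_join:
  assumes y: "y \<in> profiles"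
  shows "info_payoff \<beta> W S (separable W \<theta> h) (join y) \<omega> T \<mu> =
    - (real T + 1) * ((1 - \<beta>) * \<theta>) - (\<Sum>n\<in>projects. outcome n (y n) None)
    + (\<Sum>t\<le>T. \<Sum>l\<in>UNIV. \<mu> t $ l * (bvec W $ l - (\<Sum>n\<in>projects. outcome n (y n) (Some (t, l)))))"
proof -
  define st where "st n t = stage_gain \<beta> (proj W n) (h n) (state_at S n (y n) \<omega> t) (y n t)" for n t
  have step: "joint_rew W x (join y t) + \<beta> * (\<integral>z. separable W \<theta> h z \<partial>joint_trans W x (join y t))
        - separable W \<theta> h x + \<mu> t \<bullet> (bvec W - joint_constr W x (join y t))
      = - ((1 - \<beta>) * \<theta>) + (\<Sum>n\<in>projects. st n t)
        + (\<Sum>l\<in>UNIV. \<mu> t $ l * (bvec W $ l - (\<Sum>n\<in>projects. outcome n (y n) (Some (t, l)))))"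
    if t: "t \<le> T" and x: "x = joint_state_at W S (join y) \<omega> t" for t x
  proof -
    have xn: "x n = state_at S n (y n) \<omega> t" and yn: "join y t n = y n t" if "n \<in> projects" for n
      using that t joint_state_at_join[OF t that] by (simp_all add: x join_def)
    have feas: "(x n, join y t n) \<in> feas (proj W n)" if n: "n \<in> projects" for n
      unfolding xn[OF n] yn[OF n] using path_feas[OF n _ t] y n by blast
    have "(\<integral>z. separable W \<theta> h z \<partial>joint_trans W x (join y t))
        = \<theta> + (\<Sum>n\<in>projects. \<integral>z. h n z \<partial>trans_law (proj W n) (x n) (join y t n))"
      by (intro integral_separable W h feas)
    moreover have "joint_rew W x (join y t) - (\<Sum>n\<in>projects. h n (x n))
        + \<beta> * (\<Sum>n\<in>projects. \<integral>z. h n z \<partial>trans_law (proj W n) (x n) (join y t n))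
        = (\<Sum>n\<in>projects. st n t)"
      unfolding joint_rew_def sum_distrib_left sum_subtractf[symmetric] sum.distrib[symmetric]
      by (intro sum.cong refl) (simp add: st_def stage_gain_def xn yn)
    moreover have "\<mu> t \<bullet> (bvec W - joint_constr W x (join y t))
        = (\<Sum>l\<in>UNIV. \<mu> t $ l * (bvec W $ l - (\<Sum>n\<in>projects. outcome n (y n) (Some (t, l)))))"
      using t by (simp add: x joint_constr_join outcome_def inner_vec_def)
    ultimately show ?thesis by (simp add: separable_def algebra_simps)
  qed
  have "(\<Sum>t\<le>T. \<Sum>n\<in>projects. st n t) = - (\<Sum>n\<in>projects. outcome n (y n) None)"
    by (subst sum.swap) (simp add: outcome_def proj_payoff_def st_def sum_negf)
  moreover have "info_payoff \<beta> W S (separable W \<theta> h) (join y) \<omega> T \<mu>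
      = (\<Sum>t\<le>T. - ((1 - \<beta>) * \<theta>) + (\<Sum>n\<in>projects. st n t)
          + (\<Sum>l\<in>UNIV. \<mu> t $ l * (bvec W $ l - (\<Sum>n\<in>projects. outcome n (y n) (Some (t, l))))))"
    unfolding info_payoff_def Let_def by (intro sum.cong refl step) auto
  ultimately show ?thesis by (simp only: sum.distrib) (simp add: algebra_simps)
qed

text \<open>
  Outcomes are a continuous image of the compact set in Assumption 2.
\<close>

lemma compact_outcomes: "n \<in> projects \<Longrightarrow> compact (outcome n ` paths n)"
  and paths_nonempty: "n \<in> projects \<Longrightarrow> paths n \<noteq> {}"
proof -
  assume n: "n \<in> projects"
  let ?Z = "(\<lambda>a. (a, \<lambda>t\<in>{..T}. proj_constr W S n t a \<omega>, proj_payoff \<beta> W S n (h n) a \<omega> T)) ` paths n"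
  have Z: "?Z \<noteq> {}" "compact ?Z" using assumption2 n by (simp_all add: assumption2_def Let_def)
  then show "paths n \<noteq> {}" by auto
  define \<Phi> :: "(nat \<Rightarrow> action) \<times> (nat \<Rightarrow> real ^ 'l) \<times> real \<Rightarrow> (nat \<times> 'l) option \<Rightarrow> real" where
    "\<Phi> z j = (case j of None \<Rightarrow> - snd (snd z)
      | Some (t, l) \<Rightarrow> if t \<le> T then fst (snd z) t $ l else 0)" for z j
  have "continuous_on UNIV (\<lambda>z. \<Phi> z j)" for j
  proof -
    have "continuous_on UNIV (\<lambda>z :: (nat \<Rightarrow> action) \<times> (nat \<Rightarrow> real ^ 'l) \<times> real. fst (snd z) t)" for t
      by (rule continuous_on_product_then_coordinatewise) (intro continuous_intros)
    then have "continuous_on UNIV (\<lambda>z :: (nat \<Rightarrow> action) \<times> (nat \<Rightarrow> real ^ 'l) \<times> real.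
        if t \<le> T then fst (snd z) t $ l else 0)" for t l
      by (cases "t \<le> T") (auto intro: bounded_linear.continuous_on[OF bounded_linear_vec_nth])
    then show ?thesis
      by (cases j) (auto simp: \<Phi>_def intro!: continuous_intros)
  qed
  then have "continuous_on UNIV \<Phi>" by (intro continuous_on_coordinatewise_then_product)
  then have "compact (\<Phi> ` ?Z)"
    by (intro compact_continuous_image Z(2)) (rule continuous_on_subset, auto)
  moreover have "\<Phi> ` ?Z = outcome n ` paths n"
    unfolding image_image by (intro image_cong refl ext) (auto simp: \<Phi>_def outcome_def split: option.split)
  ultimately show "compact (outcome n ` paths n)" by simp
qed

lemma outcomes_bounded:
  obtains B where "\<And>n a j. n \<in> projects \<Longrightarrow> a \<in> paths n \<Longrightarrow> \<bar>outcome n a j\<bar> \<le> B n j"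
proof -
  have "\<exists>B. \<forall>a\<in>paths n. \<bar>outcome n a j\<bar> \<le> B" if "n \<in> projects" for n j
  proof -
    have "continuous_on (outcome n ` paths n) (\<lambda>z. z j)"
      by (rule continuous_on_product_then_coordinatewise[OF continuous_on_id])
    then have "compact ((\<lambda>z. z j) ` outcome n ` paths n)"
      using compact_outcomes[OF that] by (rule compact_continuous_image)
    then have "bounded ((\<lambda>z. z j) ` outcome n ` paths n)" by (rule compact_imp_bounded)
    then show ?thesis by (auto simp: bounded_iff)
  qed
  then show thesis using that by metis
qed

end

section \<open>The duality gap of a fixed scenario\<close>

context fixed_scenario begin

abbreviation payoff where
  "payoff y \<mu> \<equiv> info_payoff \<beta> W S (separable W \<theta> h) (join y) \<omega> T \<mu>"

text \<open>
  This bound and the next three lemmas make the real suprema and infima in the primal and dual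
  values meaningful, and yield weak duality.
\<close>

lemma payoff_bounded: obtains B where "\<And>y. y \<in> profiles \<Longrightarrow> payoff y \<mu> \<le> B"
proof -
  obtain B where B: "\<And>n a j. n \<in> projects \<Longrightarrow> a \<in> paths n \<Longrightarrow> \<bar>outcome n a j\<bar> \<le> B n j"
    using outcomes_bounded by blast
  show thesis
  proof
    fix y assume y: "y \<in> profiles"
    have b: "\<bar>\<Sum>n\<in>projects. outcome n (y n) j\<bar> \<le> (\<Sum>n\<in>projects. B n j)" for j
      using B y by (intro order_trans[OF sum_abs] sum_mono) auto
    have "\<mu> t $ l * (bvec W $ l - (\<Sum>n\<in>projects. outcome n (y n) (Some (t, l))))
        \<le> \<bar>\<mu> t $ l\<bar> * (\<bar>bvec W $ l\<bar> + (\<Sum>n\<in>projects. B n (Some (t, l))))" for t l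
    proof -
      let ?d = "bvec W $ l - (\<Sum>n\<in>projects. outcome n (y n) (Some (t, l)))"
      have "\<mu> t $ l * ?d \<le> \<bar>\<mu> t $ l\<bar> * \<bar>?d\<bar>"
        unfolding abs_mult[symmetric] by (rule abs_ge_self)
      also have "\<bar>?d\<bar> \<le> \<bar>bvec W $ l\<bar> + (\<Sum>n\<in>projects. B n (Some (t, l)))"
        using b[of "Some (t, l)"] by linarith
      finally show ?thesis by (simp add: mult_left_mono)
    qed
    then have "(\<Sum>t\<le>T. \<Sum>l\<in>UNIV. \<mu> t $ l * (bvec W $ l - (\<Sum>n\<in>projects. outcome n (y n) (Some (t, l)))))
        \<le> (\<Sum>t\<le>T. \<Sum>l\<in>UNIV. \<bar>\<mu> t $ l\<bar> * (\<bar>bvec W $ l\<bar> + (\<Sum>n\<in>projects. B n (Some (t, l)))))"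
      by (intro sum_mono)
    then show "payoff y \<mu> \<le> - (real T + 1) * ((1 - \<beta>) * \<theta>) + (\<Sum>n\<in>projects. B n None)
        + (\<Sum>t\<le>T. \<Sum>l\<in>UNIV. \<bar>\<mu> t $ l\<bar> * (\<bar>bvec W $ l\<bar> + (\<Sum>n\<in>projects. B n (Some (t, l)))))"
      unfolding info_payoff_join[OF y] using b[of None] by linarith
  qed
qed

lemma lagrangian_bdd_above:
  "bdd_above ((\<lambda>a. info_payoff \<beta> W S (separable W \<theta> h) a \<omega> T \<mu>) ` joint_paths W S \<omega> T)"
proof -
  obtain B where "\<And>y. y \<in> profiles \<Longrightarrow> payoff y \<mu> \<le> B" using payoff_bounded by blast
  then show ?thesis unfolding joint_paths_eq by (auto intro!: bdd_aboveI2[of _ _ B])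
qed

lemma payoff_le_lagrangian_sup:
  assumes y: "y \<in> profiles"
    and feasible: "\<And>t. t \<le> T \<Longrightarrow> (\<Sum>n\<in>projects. proj_constr W S n t (y n) \<omega>) \<le> bvec W"
    and \<mu>: "\<And>t. t \<le> T \<Longrightarrow> 0 \<le> \<mu> t"
  shows "payoff y (\<lambda>_. 0) \<le> (SUP a\<in>joint_paths W S \<omega> T. info_payoff \<beta> W S (separable W \<theta> h) a \<omega> T \<mu>)"
proof -
  have "0 \<le> \<mu> t $ l * (bvec W $ l - (\<Sum>n\<in>projects. outcome n (y n) (Some (t, l))))" if t: "t \<le> T" for t l
  proof (rule mult_nonneg_nonneg)
    show "0 \<le> \<mu> t $ l" using \<mu>[OF t] by (simp add: less_eq_vec_def)
    show "0 \<le> bvec W $ l - (\<Sum>n\<in>projects. outcome n (y n) (Some (t, l)))"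
      using feasible[OF t] t by (simp add: less_eq_vec_def outcome_def)
  qed
  then have "0 \<le> (\<Sum>t\<le>T. \<Sum>l\<in>UNIV. \<mu> t $ l * (bvec W $ l - (\<Sum>n\<in>projects. outcome n (y n) (Some (t, l)))))"
    by (intro sum_nonneg) auto
  then have "payoff y (\<lambda>_. 0) \<le> payoff y \<mu>" unfolding info_payoff_join[OF y] by simp
  also have "\<dots> \<le> (SUP a\<in>joint_paths W S \<omega> T. info_payoff \<beta> W S (separable W \<theta> h) a \<omega> T \<mu>)"
    using y by (intro cSUP_upper lagrangian_bdd_above) (auto simp: joint_paths_eq)
  finally show ?thesis .
qed

lemma lagrangian_sup_bdd_below:
  "bdd_below ((\<lambda>\<mu>. SUP a\<in>joint_paths W S \<omega> T. info_payoff \<beta> W S (separable W \<theta> h) a \<omega> T \<mu>)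
     ` {\<mu>. \<forall>t\<le>T. 0 \<le> \<mu> t})"
proof -
  obtain y where y: "y \<in> profiles"
    "\<And>t. t \<le> T \<Longrightarrow> (\<Sum>n\<in>projects. proj_constr W S n t (y n) \<omega>) \<le> bvec W"
    by (rule feasible_profile) blast
  show ?thesis by (rule bdd_belowI2[of _ "payoff y (\<lambda>_. 0)"], rule payoff_le_lagrangian_sup[OF y]) simp_all
qed

lemma primal_le_dual:
  "primal_value \<beta> W S (separable W \<theta> h) \<omega> T \<le> dual_value \<beta> W S (separable W \<theta> h) \<omega> T"
  unfolding primal_value_def dual_value_def
proof (intro cSUP_least cINF_greatest)
  show "joint_paths_bar W S \<omega> T \<noteq> {}" by (rule joint_paths_bar_nonempty)
  show "{\<mu>::nat \<Rightarrow> real ^ 'l. \<forall>t\<le>T. 0 \<le> \<mu> t} \<noteq> {}" by auto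
qed (auto simp: joint_paths_bar_eq intro!: payoff_le_lagrangian_sup)

lemma proj_payoff_diff_le:
  assumes n: "n \<in> projects" and a: "a \<in> paths n" "a' \<in> paths n" and K: "Gam \<beta> (proj W n) (h n) \<le> K"
  shows "proj_payoff \<beta> W S n (h n) a \<omega> T - proj_payoff \<beta> W S n (h n) a' \<omega> T \<le> (real T + 1) * K"
proof -
  have "proj_payoff \<beta> W S n (h n) a \<omega> T - proj_payoff \<beta> W S n (h n) a' \<omega> T \<le> (\<Sum>t\<le>T. K)"
    unfolding proj_payoff_def sum_subtractf[symmetric]
    using stage_gain_diff_le_Gam[OF is_project h path_feas path_feas] n a K
    by (intro sum_mono order_trans[OF _ K]) auto
  then show ?thesis by (simp add: algebra_simps)
qed

text \<open>
  Assumption 3 supplies a path below the convex closure, hence below this particular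
  combination, in all constraints. Its payoff is within \<open>(T + 1) * K\<close> of that of every other path of
  the project, hence also of their average.
\<close>

lemma convex_combination_dominated:
  fixes m :: nat
  assumes n: "n \<in> projects" and K: "Gam \<beta> (proj W n) (h n) \<le> K"
    and e: "\<And>k. k < m \<Longrightarrow> 0 \<le> q k \<and> e k \<in> paths n" and q: "(\<Sum>k<m. q k) = 1"
  obtains a where "a \<in> paths n"
    "\<And>t l. t \<le> T \<Longrightarrow> outcome n a (Some (t, l)) \<le> (\<Sum>k<m. q k * outcome n (e k) (Some (t, l)))"
    "outcome n a None \<le> (\<Sum>k<m. q k * outcome n (e k) None) + (real T + 1) * K"
proof -
  define c where "c = (\<lambda>t i. \<Sum>k<m. q k * e k t i)"
  have rep: "(m, q, e) \<in> convex_reps (paths n) c"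
    using e q by (auto simp: convex_reps_def c_def)
  then obtain a where a: "a \<in> paths n" "\<And>t. t \<le> T \<Longrightarrow> proj_constr W S n t a \<omega> \<le> cl_constr W S n T t c \<omega>"
    using assumption3 n unfolding assumption3_def conv_paths_def by blast
  obtain B where B: "\<And>a j. a \<in> paths n \<Longrightarrow> \<bar>outcome n a j\<bar> \<le> B j"
    using outcomes_bounded n by metis
  have constr: "outcome n a (Some (t, l)) \<le> (\<Sum>k<m. q k * outcome n (e k) (Some (t, l)))" if t: "t \<le> T" for t l
  proof -
    \<comment> \<open>The closure is a real infimum, so comparing it with one representation needs a lower bound.\<close>
    let ?mix = "\<lambda>(m, q, d). \<Sum>k<m. q k * proj_constr W S n t (d k) \<omega> $ l"
    have "- B (Some (t, l)) \<le> ?mix z" if z: "z \<in> convex_reps (paths n) c" for z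
    proof -
      obtain m' q' d where z: "z = (m', q', d)" "\<And>k. k < m' \<Longrightarrow> 0 \<le> q' k \<and> d k \<in> paths n"
          "(\<Sum>k<m'. q' k) = 1"
        using z by (auto simp: convex_reps_def)
      have "- B (Some (t, l)) = (\<Sum>k<m'. q' k * - B (Some (t, l)))"
        unfolding sum_distrib_right[symmetric] z(3) by simp
      also have "\<dots> \<le> (\<Sum>k<m'. q' k * proj_constr W S n t (d k) \<omega> $ l)"
      proof (intro sum_mono mult_left_mono)
        fix k assume "k \<in> {..<m'}"
        then have k: "0 \<le> q' k" "d k \<in> paths n" using z(2) by auto
        show "- B (Some (t, l)) \<le> proj_constr W S n t (d k) \<omega> $ l"
          using B[OF k(2), of "Some (t, l)"] t by (simp add: outcome_def abs_le_iff minus_le_iff)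
        show "0 \<le> q' k" by (rule k(1))
      qed
      finally show ?thesis by (simp add: z(1))
    qed
    then have "bdd_below (?mix ` convex_reps (paths n) c)" by (rule bdd_belowI2)
    then have "(INF z\<in>convex_reps (paths n) c. ?mix z) \<le> ?mix (m, q, e)"
      using rep by (rule cINF_lower)
    moreover have "proj_constr W S n t a \<omega> $ l \<le> cl_constr W S n T t c \<omega> $ l"
      using a(2)[OF t] by (simp add: less_eq_vec_def)
    ultimately show ?thesis using t by (simp add: outcome_def cl_constr_def)
  qed
  have "(\<Sum>k<m. q k * (outcome n a None - outcome n (e k) None)) \<le> (\<Sum>k<m. q k * ((real T + 1) * K))"
    using e proj_payoff_diff_le[OF n _ a(1) K]
    by (intro sum_mono mult_left_mono) (auto simp: outcome_def)
  then have "outcome n a None \<le> (\<Sum>k<m. q k * outcome n (e k) None) + (real T + 1) * K"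
    using q by (simp add: right_diff_distrib sum_subtractf flip: sum_distrib_right)
  then show thesis using that a(1) constr by blast
qed

text \<open>
  For \<open>r\<close> below the dual value, the inequalities ask for a feasible profile with payoff at least \<open>r\<close>.
  A multiplier \<open>\<nu>\<close> that refutes them would, if the weight \<open>\<nu> None\<close> of the payoff is positive, give the
  dual point \<open>\<nu> / \<nu> None\<close> of value at most \<open>r\<close>; if this weight is zero, it would contradict the
  existence of a feasible profile.
\<close>

lemma dual_le_primal:
  assumes K: "0 \<le> K" "\<And>n. n \<in> projects \<Longrightarrow> Gam \<beta> (proj W n) (h n) \<le> K"
  shows "dual_value \<beta> W S (separable W \<theta> h) \<omega> T
    \<le> primal_value \<beta> W S (separable W \<theta> h) \<omega> T + real (card coords) * ((real T + 1) * K)"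
proof (rule dense_le)
  fix r assume r: "r < dual_value \<beta> W S (separable W \<theta> h) \<omega> T"
  define r0 where "r0 = - (real T + 1) * ((1 - \<beta>) * \<theta>)"
  define b where "b j = (case j of None \<Rightarrow> r0 - r | Some (t, l) \<Rightarrow> bvec W $ l)" for j :: "(nat \<times> 'l) option"
  \<comment> \<open>By Assumption 3, rounding increases only the payoff coordinate.\<close>
  define \<rho> where "\<rho> j = (case j of None \<Rightarrow> (real T + 1) * K | Some _ \<Rightarrow> 0)" for j :: "(nat \<times> 'l) option"
  have "\<exists>z. (\<forall>n\<in>projects. z n \<in> outcome n ` paths n) \<and>
      (\<forall>j\<in>coords. (\<Sum>n\<in>projects. z n j) \<le> b j + real (card coords) * \<rho> j)"
  proof (rule shapley_folkman_rounding)
    fix n m :: nat and q :: "nat \<Rightarrow> real" and d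
    assume n: "n \<in> projects" and d: "\<And>k. k < m \<Longrightarrow> 0 \<le> q k \<and> d k \<in> outcome n ` paths n"
      and q: "(\<Sum>k<m. q k) = 1"
    obtain e where e: "\<And>k. k < m \<Longrightarrow> e k \<in> paths n \<and> d k = outcome n (e k)"
      using d unfolding image_iff by metis
    obtain a where a: "a \<in> paths n"
      "\<And>t l. t \<le> T \<Longrightarrow> outcome n a (Some (t, l)) \<le> (\<Sum>k<m. q k * outcome n (e k) (Some (t, l)))"
      "outcome n a None \<le> (\<Sum>k<m. q k * outcome n (e k) None) + (real T + 1) * K"
      using convex_combination_dominated[OF n K(2)[OF n], of m q e] d e q by blast
    have "(\<Sum>k<m. q k * d k j) = (\<Sum>k<m. q k * outcome n (e k) j)" for j
      using e by (intro sum.cong) auto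
    then show "\<exists>y\<in>outcome n ` paths n. \<forall>j\<in>coords. y j \<le> (\<Sum>k<m. q k * d k j) + \<rho> j"
      using a by (intro bexI[of _ "outcome n a"]) (auto simp: coords_def \<rho>_def)
  next
    fix \<nu> :: "(nat \<times> 'l) option \<Rightarrow> real" assume \<nu>: "\<And>j. 0 \<le> \<nu> j"
    have "\<exists>y\<in>profiles. (\<Sum>j\<in>coords. \<nu> j * (\<Sum>n\<in>projects. outcome n (y n) j)) \<le> (\<Sum>j\<in>coords. \<nu> j * b j)"
    proof (cases "\<nu> None = 0")
      case True
      obtain y where y: "y \<in> profiles"
        "\<And>t. t \<le> T \<Longrightarrow> (\<Sum>n\<in>projects. proj_constr W S n t (y n) \<omega>) \<le> bvec W"
        by (rule feasible_profile) blast
      have "(\<Sum>j\<in>coords. \<nu> j * (\<Sum>n\<in>projects. outcome n (y n) j)) \<le> (\<Sum>j\<in>coords. \<nu> j * b j)"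
        unfolding sum_coords using True y(2) \<nu>
        by (auto intro!: sum_mono mult_left_mono simp: outcome_def b_def less_eq_vec_def)
      then show ?thesis using y(1) by blast
    next
      case False
      define s where "s = \<nu> None"
      have s: "0 < s" using False \<nu>[of None] by (simp add: s_def)
      define \<mu> :: "nat \<Rightarrow> real ^ 'l" where "\<mu> t = (\<chi> l. \<nu> (Some (t, l)) / s)" for t
      have "r < (SUP a\<in>joint_paths W S \<omega> T. info_payoff \<beta> W S (separable W \<theta> h) a \<omega> T \<mu>)"
        using r unfolding dual_value_def
      proof (rule less_le_trans)
        show "(INF \<mu>\<in>{\<mu>. \<forall>t\<le>T. 0 \<le> \<mu> t}. SUP a\<in>joint_paths W S \<omega> T. info_payoff \<beta> W S (separable W \<theta> h) a \<omega> T \<mu>)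
            \<le> (SUP a\<in>joint_paths W S \<omega> T. info_payoff \<beta> W S (separable W \<theta> h) a \<omega> T \<mu>)"
          using \<nu> s by (intro cINF_lower lagrangian_sup_bdd_below) (auto simp: \<mu>_def less_eq_vec_def)
      qed
      moreover have "joint_paths W S \<omega> T \<noteq> {}"
        using joint_paths_bar_nonempty by (auto simp: joint_paths_eq joint_paths_bar_eq)
      ultimately obtain y where y: "y \<in> profiles" "r < payoff y \<mu>"
        using less_cSUP_iff[OF _ lagrangian_bdd_above] unfolding joint_paths_eq by blast
      have "s * r \<le> s * payoff y \<mu>" using y(2) s by simp
      also have "\<dots> = s * r0 - s * (\<Sum>n\<in>projects. outcome n (y n) None)
          + (\<Sum>t\<le>T. \<Sum>l\<in>UNIV. \<nu> (Some (t, l)) * (bvec W $ l - (\<Sum>n\<in>projects. outcome n (y n) (Some (t, l)))))"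
        unfolding info_payoff_join[OF y(1)] r0_def[symmetric] distrib_left right_diff_distrib[of s]
          sum_distrib_left[of s]
        using s by (simp add: \<mu>_def)
      finally have "(\<Sum>j\<in>coords. \<nu> j * (\<Sum>n\<in>projects. outcome n (y n) j)) \<le> (\<Sum>j\<in>coords. \<nu> j * b j)"
        unfolding sum_coords
        by (simp add: b_def s_def right_diff_distrib sum_subtractf)
      then show ?thesis using y(1) by blast
    qed
    then obtain y where "y \<in> profiles"
        "(\<Sum>j\<in>coords. \<nu> j * (\<Sum>n\<in>projects. outcome n (y n) j)) \<le> (\<Sum>j\<in>coords. \<nu> j * b j)" by blast
    then show "\<exists>z. (\<forall>n\<in>projects. z n \<in> outcome n ` paths n) \<and>
        (\<Sum>j\<in>coords. \<nu> j * (\<Sum>n\<in>projects. z n j)) \<le> (\<Sum>j\<in>coords. \<nu> j * b j)"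
      by (intro exI[of _ "\<lambda>n. outcome n (y n)"]) auto
  next
    show "0 \<le> \<rho> j" for j using K(1) by (simp add: \<rho>_def split: option.split)
  qed (use paths_nonempty in \<open>auto intro: finite_coords compact_outcomes\<close>)
  then obtain z where z: "\<And>n. n \<in> projects \<Longrightarrow> z n \<in> outcome n ` paths n"
      "\<And>j. j \<in> coords \<Longrightarrow> (\<Sum>n\<in>projects. z n j) \<le> b j + real (card coords) * \<rho> j" by blast
  obtain y where y: "\<And>n. n \<in> projects \<Longrightarrow> y n \<in> paths n \<and> z n = outcome n (y n)"
    using z(1) unfolding image_iff by metis
  have le: "(\<Sum>n\<in>projects. outcome n (y n) j) \<le> b j + real (card coords) * \<rho> j" if "j \<in> coords" for j
    using z(2)[OF that] y by simp
  have prof: "y \<in> profiles" using y by simp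
  have "(\<Sum>n\<in>projects. proj_constr W S n t (y n) \<omega>) \<le> bvec W" if t: "t \<le> T" for t
    using le[of "Some (t, _)"] t by (simp add: coords_def less_eq_vec_def outcome_def b_def \<rho>_def)
  then have bar: "join y \<in> joint_paths_bar W S \<omega> T" using prof unfolding joint_paths_bar_eq by blast
  have "r \<le> r0 - (\<Sum>n\<in>projects. outcome n (y n) None) + real (card coords) * ((real T + 1) * K)"
    using le[of None] by (simp add: coords_def b_def \<rho>_def)
  also have "r0 - (\<Sum>n\<in>projects. outcome n (y n) None) = payoff y (\<lambda>_. 0)"
    unfolding info_payoff_join[OF prof] by (simp add: r0_def)
  also have "payoff y (\<lambda>_. 0) \<le> primal_value \<beta> W S (separable W \<theta> h) \<omega> T"
    unfolding primal_value_def
    by (intro cSUP_upper bar bdd_above_mono[OF lagrangian_bdd_above] image_mono)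
       (auto simp: joint_paths_eq joint_paths_bar_eq)
  finally show "r \<le> primal_value \<beta> W S (separable W \<theta> h) \<omega> T + real (card coords) * ((real T + 1) * K)"
    by simp
qed

lemma abs_duality_gap_le:
  assumes K: "0 \<le> K" "\<And>n. n \<in> projects \<Longrightarrow> Gam \<beta> (proj W n) (h n) \<le> K"
  shows "\<bar>dual_value \<beta> W S (separable W \<theta> h) \<omega> T - primal_value \<beta> W S (separable W \<theta> h) \<omega> T\<bar>
    \<le> (real CARD('l) + 1) * K * (real T + 1)\<^sup>2"
proof -
  have "real (card coords) \<le> (real CARD('l) + 1) * (real T + 1)"
    by (simp add: card_coords algebra_simps)
  then have "real (card coords) * ((real T + 1) * K) \<le> (real CARD('l) + 1) * (real T + 1) * ((real T + 1) * K)"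
    using K(1) by (intro mult_right_mono) auto
  then show ?thesis using dual_le_primal[OF K] primal_le_dual
    by (simp add: power2_eq_square mult_ac)
qed

text \<open>
  A crude bound, which may depend on the number of projects: it only serves integrability.
\<close>

lemma abs_primal_value_le:
  assumes M: "\<And>n x a. n \<in> projects \<Longrightarrow> (x, a) \<in> feas (proj W n) \<Longrightarrow> \<bar>stage_gain \<beta> (proj W n) (h n) x a\<bar> \<le> M n"
  shows "\<bar>primal_value \<beta> W S (separable W \<theta> h) \<omega> T\<bar> \<le> (real T + 1) * (\<bar>(1 - \<beta>) * \<theta>\<bar> + (\<Sum>n\<in>projects. M n))"
  unfolding primal_value_def
proof (rule cSup_abs_le)
  show "(\<lambda>a. info_payoff \<beta> W S (separable W \<theta> h) a \<omega> T (\<lambda>_. 0)) ` joint_paths_bar W S \<omega> T \<noteq> {}"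
    using joint_paths_bar_nonempty by simp
next
  fix v assume "v \<in> (\<lambda>a. info_payoff \<beta> W S (separable W \<theta> h) a \<omega> T (\<lambda>_. 0)) ` joint_paths_bar W S \<omega> T"
  then obtain y where y: "y \<in> profiles" "v = payoff y (\<lambda>_. 0)" by (auto simp: joint_paths_bar_eq)
  have "\<bar>outcome n (y n) None\<bar> \<le> (real T + 1) * M n" if n: "n \<in> projects" for n
  proof -
    have "\<bar>outcome n (y n) None\<bar> \<le> (\<Sum>t\<le>T. M n)"
      unfolding outcome_def proj_payoff_def option.case abs_minus_cancel
      using path_feas[OF n] y(1) n by (intro order_trans[OF sum_abs] sum_mono M) auto
    then show ?thesis by (simp add: algebra_simps)
  qed
  then have "\<bar>\<Sum>n\<in>projects. outcome n (y n) None\<bar> \<le> (real T + 1) * (\<Sum>n\<in>projects. M n)"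
    unfolding sum_distrib_left by (intro order_trans[OF sum_abs] sum_mono)
  moreover have "v = - ((real T + 1) * ((1 - \<beta>) * \<theta>)) - (\<Sum>n\<in>projects. outcome n (y n) None)"
    unfolding y(2) info_payoff_join[OF y(1)] by (simp add: algebra_simps)
  moreover have "\<bar>(real T + 1) * ((1 - \<beta>) * \<theta>)\<bar> = (real T + 1) * \<bar>(1 - \<beta>) * \<theta>\<bar>"
    unfolding abs_mult[of "real T + 1"] by simp
  ultimately show "\<bar>v\<bar> \<le> (real T + 1) * (\<bar>(1 - \<beta>) * \<theta>\<bar> + (\<Sum>n\<in>projects. M n))"
    unfolding distrib_left by linarith
qed

end

section \<open>Averaging over scenarios and the random horizon\<close>

text \<open>
  The second formal derivative of the geometric series has the coefficients \<open>(n + 1) * (n + 2)\<close>, which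
  dominate \<open>(n + 1)\<^sup>2\<close>.
\<close>

lemma summable_square_times_geometric:
  assumes "0 < \<beta>" "\<beta> < (1::real)"
  shows "summable (\<lambda>n. (real n + 1)\<^sup>2 * \<beta> ^ n)"
proof -
  have 1: "summable (\<lambda>n. diffs (\<lambda>_. 1) n * x ^ n)" if "norm x < 1" for x :: real
    using that by (rule termdiff_converges) (simp add: summable_geometric)
  have "summable (\<lambda>n. diffs (diffs (\<lambda>_. 1)) n * \<beta> ^ n)"
    by (rule termdiff_converges[of _ 1]) (use assms 1 in auto)
  then show ?thesis
  proof (rule summable_comparison_test'[of _ 0])
    fix n
    have "(real n + 1)\<^sup>2 \<le> diffs (diffs (\<lambda>_. 1)) n"
      by (simp add: diffs_def power2_eq_square algebra_simps)
    then show "norm ((real n + 1)\<^sup>2 * \<beta> ^ n) \<le> diffs (diffs (\<lambda>_. 1)) n * \<beta> ^ n"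
      using assms by (simp add: mult_right_mono)
  qed
qed

lemma integrable_square_geometric_pmf:
  assumes "0 < \<beta>" "\<beta> < (1::real)"
  shows "integrable (measure_pmf (geometric_pmf (1 - \<beta>))) (\<lambda>T. (real T + 1)\<^sup>2)"
proof -
  have "summable (\<lambda>n. (1 - \<beta>) * ((real n + 1)\<^sup>2 * \<beta> ^ n))"
    by (intro summable_mult summable_square_times_geometric assms)
  moreover have "norm (pmf (geometric_pmf (1 - \<beta>)) n * (real n + 1)\<^sup>2) = (1 - \<beta>) * ((real n + 1)\<^sup>2 * \<beta> ^ n)" for n
    using assms by (simp add: pmf_geometric mult_ac)
  ultimately have "integrable (count_space UNIV) (\<lambda>n. pmf (geometric_pmf (1 - \<beta>)) n * (real n + 1)\<^sup>2)"
    unfolding integrable_count_space_nat_iff by (simp only:)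
  then show ?thesis
    unfolding measure_pmf_eq_density by (subst integrable_density) auto
qed

text \<open>
  The bound on \<open>f\<close> keeps both integrals from being the default value zero of a nonintegrable function.
\<close>

lemma abs_integral_diff_le:
  fixes f g :: "'w \<Rightarrow> nat \<Rightarrow> real" and p :: "nat pmf" and k :: "nat \<Rightarrow> real"
  assumes Q: "prob_space Q"
    and meas: "\<And>T. (\<lambda>\<omega>. f \<omega> T) \<in> borel_measurable Q" "\<And>T. (\<lambda>\<omega>. g \<omega> T) \<in> borel_measurable Q"
    and k: "integrable (measure_pmf p) k"
    and f: "\<And>\<omega> T. \<omega> \<in> space Q \<Longrightarrow> \<bar>f \<omega> T\<bar> \<le> A * k T"
    and gf: "\<And>\<omega> T. \<omega> \<in> space Q \<Longrightarrow> \<bar>g \<omega> T - f \<omega> T\<bar> \<le> B * k T"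
  shows "\<bar>(\<integral>(\<omega>, T). g \<omega> T \<partial>(Q \<Otimes>\<^sub>M measure_pmf p)) - (\<integral>(\<omega>, T). f \<omega> T \<partial>(Q \<Otimes>\<^sub>M measure_pmf p))\<bar>
    \<le> B * (\<integral>T. k T \<partial>measure_pmf p)"
proof -
  interpret Q: prob_space Q by (rule Q)
  interpret P: pair_prob_space Q "measure_pmf p" ..
  let ?P = "Q \<Otimes>\<^sub>M measure_pmf p"
  have pair_meas: "(\<lambda>(\<omega>, T). u \<omega> T) \<in> borel_measurable ?P"
    if "\<And>T. (\<lambda>\<omega>. u \<omega> T) \<in> borel_measurable Q" for u :: "'w \<Rightarrow> nat \<Rightarrow> real"
  proof -
    have "(\<lambda>z. u (fst z) (snd z)) \<in> borel_measurable ?P"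
    proof (rule measurable_compose_countable[where f = "\<lambda>T z. u (fst z) T" and g = snd])
      show "(\<lambda>z. u (fst z) T) \<in> borel_measurable ?P" for T
        using that by (rule measurable_compose[OF measurable_fst])
      show "snd \<in> ?P \<rightarrow>\<^sub>M count_space UNIV"
        using measurable_snd[of Q "measure_pmf p"] by (simp cong: measurable_cong_sets)
    qed
    then show ?thesis by (simp add: case_prod_beta')
  qed
  have k_int: "integrable ?P (\<lambda>(\<omega>, T). k T)"
  proof (rule P.Fubini_integrable)
    show "(\<lambda>(\<omega>, T). k T) \<in> borel_measurable ?P" by (rule pair_meas) simp
  qed (use k in simp_all)
  have k_eq: "(\<integral>(\<omega>, T). k T \<partial>?P) = (\<integral>T. k T \<partial>measure_pmf p)"
    using P.integral_fst'[OF k_int] by (simp add: Q.prob_space)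
  have f_int: "integrable ?P (\<lambda>(\<omega>, T). f \<omega> T)"
  proof (rule Bochner_Integration.integrable_bound)
    show "integrable ?P (\<lambda>z. A * (\<lambda>(\<omega>, T). k T) z)" by (intro integrable_mult_right k_int)
    show "AE z in ?P. norm (case z of (\<omega>, T) \<Rightarrow> f \<omega> T) \<le> norm (A * (case z of (\<omega>, T) \<Rightarrow> k T))"
      using f by (intro AE_I2) (force simp: space_pair_measure intro: order_trans[OF _ abs_ge_self])
  qed (intro pair_meas meas)
  have d_int: "integrable ?P (\<lambda>(\<omega>, T). g \<omega> T - f \<omega> T)"
  proof (rule Bochner_Integration.integrable_bound)
    show "integrable ?P (\<lambda>z. B * (\<lambda>(\<omega>, T). k T) z)" by (intro integrable_mult_right k_int)
    show "AE z in ?P. norm (case z of (\<omega>, T) \<Rightarrow> g \<omega> T - f \<omega> T) \<le> norm (B * (case z of (\<omega>, T) \<Rightarrow> k T))"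
      using gf by (intro AE_I2) (force simp: space_pair_measure intro: order_trans[OF _ abs_ge_self])
  qed (intro pair_meas borel_measurable_diff meas)
  have "(\<integral>(\<omega>, T). g \<omega> T \<partial>?P) = (\<integral>z. (\<lambda>(\<omega>, T). g \<omega> T - f \<omega> T) z + (\<lambda>(\<omega>, T). f \<omega> T) z \<partial>?P)"
    by (intro Bochner_Integration.integral_cong) auto
  also have "\<dots> = (\<integral>(\<omega>, T). g \<omega> T - f \<omega> T \<partial>?P) + (\<integral>(\<omega>, T). f \<omega> T \<partial>?P)"
    using d_int f_int by (rule Bochner_Integration.integral_add)
  finally have "\<bar>(\<integral>(\<omega>, T). g \<omega> T \<partial>?P) - (\<integral>(\<omega>, T). f \<omega> T \<partial>?P)\<bar> = \<bar>\<integral>(\<omega>, T). g \<omega> T - f \<omega> T \<partial>?P\<bar>"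
    by simp
  also have "\<dots> \<le> (\<integral>z. \<bar>case z of (\<omega>, T) \<Rightarrow> g \<omega> T - f \<omega> T\<bar> \<partial>?P)" by (rule integral_abs_bound)
  also have "\<dots> \<le> (\<integral>z. B * (\<lambda>(\<omega>, T). k T) z \<partial>?P)"
    using gf by (intro integral_mono integrable_abs d_int integrable_mult_right k_int)
      (force simp: space_pair_measure)
  also have "\<dots> = B * (\<integral>T. k T \<partial>measure_pmf p)" by (simp only: integral_mult_right_zero k_eq)
  finally show ?thesis .
qed

text \<open>
  The duality gap is bounded for every scenario, so the bound holds for every initial state and not
  only almost surely.
\<close>

lemma abs_bound_difference_le:
  fixes W :: "('s, 'l::finite) wcdp" and S :: "('s, 'w) scenarios"
  assumes \<beta>: "0 < \<beta>" "\<beta> < 1" and W: "is_wcdp W" and S: "is_scenarios W S"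
    and h: "\<And>n. n \<in> {1..nproj W} \<Longrightarrow> bounded_measurable (states (proj W n)) (h n)"
    and meas: "values_measurable \<beta> W S (separable W \<theta> h)"
    and a1: "assumption1 W"
    and a23: "\<And>\<omega> T. \<omega> \<in> space (scen S) \<Longrightarrow> assumption2 \<beta> W S h \<omega> T \<and> assumption3 W S \<omega> T"
    and K: "0 \<le> K" "\<And>n. n \<in> {1..nproj W} \<Longrightarrow> Gam \<beta> (proj W n) (h n) \<le> K"
    and x: "x \<in> space (joint_states W)"
  shows "\<bar>L_circ_bound \<beta> W S (separable W \<theta> h) x - L_bound \<beta> W S (separable W \<theta> h) x\<bar>
    \<le> (real CARD('l) + 1) * K * (\<integral>T. (real T + 1)\<^sup>2 \<partial>measure_pmf (geometric_pmf (1 - \<beta>)))"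
proof -
  let ?H = "separable W \<theta> h" and ?Q = "cond_law S x"
  have "cond_law S \<in> joint_states W \<rightarrow>\<^sub>M prob_algebra (scen S)"
    using S unfolding is_scenarios_def by (elim conjE)
  then have "?Q \<in> space (prob_algebra (scen S))" using x by (rule measurable_space)
  then have Q: "prob_space ?Q" "sets ?Q = sets (scen S)" by (auto simp: space_prob_algebra)
  then have Q_space: "space ?Q = space (scen S)" by (intro sets_eq_imp_space_eq)
  have scenario: "fixed_scenario \<beta> W S h \<omega> T" if "\<omega> \<in> space ?Q" for \<omega> T
    using that W S h a1 a23 unfolding Q_space by unfold_locales auto
  have "\<exists>M. \<forall>x a. (x, a) \<in> feas (proj W n) \<longrightarrow> \<bar>stage_gain \<beta> (proj W n) (h n) x a\<bar> \<le> M"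
    if n: "n \<in> {1..nproj W}" for n
  proof -
    have "is_project (proj W n)" using W n by (auto simp: is_wcdp_def)
    then show ?thesis using abs_stage_gain_bounded[OF _ h[OF n]] by metis
  qed
  then obtain M where M: "\<And>n x a. n \<in> {1..nproj W} \<Longrightarrow> (x, a) \<in> feas (proj W n) \<Longrightarrow>
      \<bar>stage_gain \<beta> (proj W n) (h n) x a\<bar> \<le> M n" by metis
  \<comment> \<open>The outer absolute value makes \<open>A\<close> nonnegative whatever the signs of the bounds \<open>M\<close>.\<close>
  define A where "A = \<bar>\<bar>(1 - \<beta>) * \<theta>\<bar> + (\<Sum>n=1..nproj W. M n)\<bar>"
  have "\<bar>(\<integral>(\<omega>, T). dual_value \<beta> W S ?H \<omega> T \<partial>(?Q \<Otimes>\<^sub>M measure_pmf (geometric_pmf (1 - \<beta>))))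
      - (\<integral>(\<omega>, T). primal_value \<beta> W S ?H \<omega> T \<partial>(?Q \<Otimes>\<^sub>M measure_pmf (geometric_pmf (1 - \<beta>))))\<bar>
    \<le> (real CARD('l) + 1) * K * (\<integral>T. (real T + 1)\<^sup>2 \<partial>measure_pmf (geometric_pmf (1 - \<beta>)))"
  proof (rule abs_integral_diff_le[where A = A])
    show "(\<lambda>\<omega>. primal_value \<beta> W S ?H \<omega> T) \<in> borel_measurable ?Q"
      "(\<lambda>\<omega>. dual_value \<beta> W S ?H \<omega> T) \<in> borel_measurable ?Q" for T
      using meas Q(2) by (auto simp: values_measurable_def cong: measurable_cong_sets)
    show "integrable (measure_pmf (geometric_pmf (1 - \<beta>))) (\<lambda>T. (real T + 1)\<^sup>2)"
      by (rule integrable_square_geometric_pmf[OF \<beta>])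
  next
    fix \<omega> T assume \<omega>: "\<omega> \<in> space ?Q"
    interpret fixed_scenario \<beta> W S \<theta> h \<omega> T by (rule scenario[OF \<omega>])
    show "\<bar>dual_value \<beta> W S ?H \<omega> T - primal_value \<beta> W S ?H \<omega> T\<bar> \<le> (real CARD('l) + 1) * K * (real T + 1)\<^sup>2"
      by (rule abs_duality_gap_le[OF K])
    have "\<bar>primal_value \<beta> W S ?H \<omega> T\<bar> \<le> (real T + 1) * (\<bar>(1 - \<beta>) * \<theta>\<bar> + (\<Sum>n=1..nproj W. M n))"
      by (rule abs_primal_value_le[OF M])
    also have "\<dots> \<le> (real T + 1) * A" unfolding A_def by (intro mult_left_mono) auto
    also have "\<dots> \<le> (real T + 1)\<^sup>2 * A"
      unfolding A_def by (intro mult_right_mono) (auto simp: power2_eq_square)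
    finally show "\<bar>primal_value \<beta> W S ?H \<omega> T\<bar> \<le> A * (real T + 1)\<^sup>2" by (simp add: mult.commute)
  qed (rule Q(1))
  then show ?thesis unfolding L_circ_bound_def L_bound_def by simp
qed

theorem corollary8:
  fixes \<beta> :: real
  assumes "0 < \<beta>" and "\<beta> < 1"
  shows
    "(\<forall>(W :: nat \<Rightarrow> ('s, 'l::finite) wcdp) (S :: nat \<Rightarrow> ('s, 'w) scenarios)
        (\<theta> :: nat \<Rightarrow> real) (h :: nat \<Rightarrow> nat \<Rightarrow> 's \<Rightarrow> real).
        (\<forall>N\<ge>1. nproj (W N) = N \<and> is_wcdp (W N) \<and> is_scenarios (W N) (S N) \<and>
           (\<forall>n\<in>{1..N}. bounded_measurable (states (proj (W N) n)) (h N n)) \<and>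
           values_measurable \<beta> (W N) (S N) (separable (W N) (\<theta> N) (h N)) \<and>
           assumption1 (W N) \<and>
           (\<forall>\<omega>\<in>space (scen (S N)). \<forall>T.
              assumption2 \<beta> (W N) (S N) (h N) \<omega> T \<and> assumption3 (W N) (S N) \<omega> T)) \<longrightarrow>
        (\<exists>K. \<forall>N\<ge>1. \<forall>n\<in>{1..N}. Gam \<beta> (proj (W N) n) (h N n) \<le> K) \<longrightarrow>
        (\<exists>C. \<forall>N\<ge>1. \<forall>x\<in>space (joint_states (W N)).
           \<bar>L_circ_bound \<beta> (W N) (S N) (separable (W N) (\<theta> N) (h N)) x
             - L_bound \<beta> (W N) (S N) (separable (W N) (\<theta> N) (h N)) x\<bar> \<le> C))
     \<and>
     (\<forall>(W :: ('s, 'l) wcdp) (lam :: real ^ 'l) (h :: nat \<Rightarrow> 's \<Rightarrow> real) (C :: real).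
        is_wcdp W \<longrightarrow> 0 \<le> lam \<longrightarrow>
        (\<forall>n\<in>{1..nproj W}. bellman_solution \<beta> lam (proj W n) (h n)) \<longrightarrow>
        0 < C \<longrightarrow>
        (\<forall>n\<in>{1..nproj W}. \<forall>(x, a)\<in>feas (proj W n).
           \<bar>rew (proj W n) x a\<bar> \<le> C \<and>
           \<bar>rew (proj W n) x a - lam \<bullet> constr (proj W n) x a\<bar> \<le> C) \<longrightarrow>
        (\<forall>n\<in>{1..nproj W}. Gam \<beta> (proj W n) (h n) \<le> 4 * C / (1 - \<beta>)))"
proof (intro conjI allI impI ballI)
  fix W :: "nat \<Rightarrow> ('s, 'l) wcdp" and S :: "nat \<Rightarrow> ('s, 'w) scenarios"
    and \<theta> :: "nat \<Rightarrow> real" and h :: "nat \<Rightarrow> nat \<Rightarrow> 's \<Rightarrow> real"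
  assume inst: "\<forall>N\<ge>1. nproj (W N) = N \<and> is_wcdp (W N) \<and> is_scenarios (W N) (S N) \<and>
           (\<forall>n\<in>{1..N}. bounded_measurable (states (proj (W N) n)) (h N n)) \<and>
           values_measurable \<beta> (W N) (S N) (separable (W N) (\<theta> N) (h N)) \<and>
           assumption1 (W N) \<and>
           (\<forall>\<omega>\<in>space (scen (S N)). \<forall>T.
              assumption2 \<beta> (W N) (S N) (h N) \<omega> T \<and> assumption3 (W N) (S N) \<omega> T)"
  assume "\<exists>K. \<forall>N\<ge>1. \<forall>n\<in>{1..N}. Gam \<beta> (proj (W N) n) (h N n) \<le> K"
  then obtain K where K: "\<And>N n. 1 \<le> N \<Longrightarrow> n \<in> {1..N} \<Longrightarrow> Gam \<beta> (proj (W N) n) (h N n) \<le> K"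
    by blast
  \<comment> \<open>Taking \<open>max 0 K\<close> provides the nonnegative bound of the gap estimate without an argument that \<open>Gam\<close> is nonnegative.\<close>
  have "\<bar>L_circ_bound \<beta> (W N) (S N) (separable (W N) (\<theta> N) (h N)) x
        - L_bound \<beta> (W N) (S N) (separable (W N) (\<theta> N) (h N)) x\<bar>
      \<le> (real CARD('l) + 1) * max 0 K * (\<integral>T. (real T + 1)\<^sup>2 \<partial>measure_pmf (geometric_pmf (1 - \<beta>)))"
    if N: "1 \<le> N" and x: "x \<in> space (joint_states (W N))" for N x
  proof -
    have N_proj: "nproj (W N) = N" using inst N by blast
    show ?thesis
    proof (rule abs_bound_difference_le[OF assms _ _ _ _ _ _ _ _ x])
      show "Gam \<beta> (proj (W N) n) (h N n) \<le> max 0 K" if "n \<in> {1..nproj (W N)}" for n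
        using K[OF N, of n] that N_proj by simp
    qed (use inst N N_proj in auto)
  qed
  then show "\<exists>C. \<forall>N\<ge>1. \<forall>x\<in>space (joint_states (W N)).
      \<bar>L_circ_bound \<beta> (W N) (S N) (separable (W N) (\<theta> N) (h N)) x
        - L_bound \<beta> (W N) (S N) (separable (W N) (\<theta> N) (h N)) x\<bar> \<le> C"
    by blast
next
  fix W :: "('s, 'l) wcdp" and lam :: "real ^ 'l" and h :: "nat \<Rightarrow> 's \<Rightarrow> real" and C :: real and n
  assume W: "is_wcdp W" and h: "\<forall>n\<in>{1..nproj W}. bellman_solution \<beta> lam (proj W n) (h n)"
    and C: "\<forall>n\<in>{1..nproj W}. \<forall>(x, a)\<in>feas (proj W n).
           \<bar>rew (proj W n) x a\<bar> \<le> C \<and>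
           \<bar>rew (proj W n) x a - lam \<bullet> constr (proj W n) x a\<bar> \<le> C"
    and n: "n \<in> {1..nproj W}"
  have "is_project (proj W n)" using W n by (auto simp: is_wcdp_def)
  moreover have "bellman_solution \<beta> lam (proj W n) (h n)" using h n by blast
  ultimately show "Gam \<beta> (proj W n) (h n) \<le> 4 * C / (1 - \<beta>)"
    using Gam_bellman_solution_le[OF assms] C n by blast
qed

end
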